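(* Let $H_0,H_1$ be complex Hilbert spaces, $G$ a densely defined closed operator from $H_0$ into $H_1$ and $D$ a densely defined closed operator from $H_1$ into $H_0$ with $-G^*\subset D$, and assume the inclusion $\mathrm{dom}(G)\hookrightarrow H_0$ is compact. Let $H$ be a Hilbert space and $\kappa\in\mathcal{L}(\mathrm{BD}(G),H)$ injective with dense range. Let $m_n,m\in\mathcal{L}(H_0)$ and $a_n,a\in\mathcal{L}(H_1)$ ($n\in\mathbb N$), and let $\mu>0$ with $\mathrm{Re}\, m_n,\mathrm{Re}\, m\ge\mu I_{H_0}$ and $\mathrm{Re}\, a_n,\mathrm{Re}\, a\ge \mu I_{H_1}$ for all $n$, and $\sup_n\|a_n\|<\infty$. Let $\Lambda_H,\Lambda_H^{(n)}$ be the Dirichlet-to-Neumann operators in $H$ associated with $-DaG+m$ and $-Da_nG+m_n$. Suppose $m_n\to m$ in the weak operator topology on $\mathcal{L}(H_0)$ and $(\iota^*a_n\iota)^{-1}\to(\iota^*a\iota)^{-1}$ in the weak operator topology on $\mathcal{L}(\mathrm{ran}(G))$. Then $(\Lambda_H^{(n)})^{-1}\to\Lambda_H^{-1}$ in the weak operator topology on $\mathcal{L}(H)$. If in addition $\kappa$ is compact, the convergence holds in operator norm in $\mathcal{L}(H)$.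
   Context: Put $\mathring D=-G^*$, $\mathring G=-D^*$. Domains carry graph inner products, e.g. $(u,v)_{\mathrm{dom}(G)}=(u,v)_{H_0}+(Gu,Gv)_{H_1}$. $\mathrm{BD}(G)$ (resp. $\mathrm{BD}(D)$) is the orthogonal complement of $\mathrm{dom}(\mathring G)$ in $\mathrm{dom}(G)$ (resp. of $\mathrm{dom}(\mathring D)$ in $\mathrm{dom}(D)$), with induced inner products; $\pi_{\mathrm{BD}(D)}$ is the orthogonal projection onto $\mathrm{BD}(D)$. $G$ maps $\mathrm{BD}(G)$ into $\mathrm{BD}(D)$. For $\mathrm{Re}\,a,\mathrm{Re}\,m$ bounded below by positive multiples of the identity and $u_0\in\mathrm{BD}(G)$ there is a unique $u\in\mathrm{dom}(G)$ with $aGu\in\mathrm{dom}(D)$, $mu-DaGu=0$, $u-u_0\in\mathrm{dom}(\mathring G)$; set $\Lambda u_0=\pi_{\mathrm{BD}(D)}(aGu)$. The operator $\Lambda_H$ in $H$: $\varphi\in\mathrm{dom}(\Lambda_H)$ and $\Lambda_H\varphi=\psi$ iff there is $u_0\in\mathrm{BD}(G)$ with $\kappa(u_0)=\varphi$ and $\Lambda u_0=G\kappa^*\psi$, where $\kappa^*\colon H\to\mathrm{BD}(G)$ is the adjoint; $\Lambda_H$ is invertible with $\Lambda_H^{-1}\in\mathcal{L}(H)$. Under the compactness assumption $\mathrm{ran}(G)$ is closed in $H_1$; it is given the norm of $H_1$, $\iota\colon\mathrm{ran}(G)\hookrightarrow H_1$ is the inclusion, and $\iota^*$ is the orthogonal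 projection of $H_1$ onto $\mathrm{ran}(G)$; $\iota^*a\iota$ is invertible on $\mathrm{ran}(G)$ since it is coercive. *)

theory Defs
  imports "HOL-Analysis.Analysis"
begin

text \<open>A complex Hilbert space is represented by a type of class real_inner and complete_space
  (a real Hilbert space) together with a map J playing the role of multiplication by i.
  The complex inner product is cinner J (linear in the first argument); its real part is the
  real inner product and it induces the same norm.\<close>

definition cstruct :: "('a::real_inner \<Rightarrow> 'a) \<Rightarrow> bool" where
  "cstruct J \<longleftrightarrow> linear J \<and> (\<forall>x. J (J x) = - x) \<and> (\<forall>x y. inner (J x) (J y) = inner x y)"

definition cinner :: "('a::real_inner \<Rightarrow> 'a) \<Rightarrow> 'a \<Rightarrow> 'a \<Rightarrow> complex" where
  "cinner J x y = Complex (inner x y) (inner x (J y))"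

definition csubspace :: "('a::real_inner \<Rightarrow> 'a) \<Rightarrow> 'a set \<Rightarrow> bool" where
  "csubspace J S \<longleftrightarrow> subspace S \<and> (\<forall>x\<in>S. J x \<in> S)"

definition clinear_on :: "('a::real_inner \<Rightarrow> 'a) \<Rightarrow> ('b::real_inner \<Rightarrow> 'b) \<Rightarrow> 'a set \<Rightarrow> ('a \<Rightarrow> 'b) \<Rightarrow> bool" where
  "clinear_on J J' S T \<longleftrightarrow> csubspace J S \<and>
     (\<forall>x\<in>S. \<forall>y\<in>S. T (x + y) = T x + T y) \<and>
     (\<forall>c. \<forall>x\<in>S. T (c *\<^sub>R x) = c *\<^sub>R T x) \<and>
     (\<forall>x\<in>S. T (J x) = J' (T x))"

definition dd_closed_op :: "('a::real_inner \<Rightarrow> 'a) \<Rightarrow> ('b::real_inner \<Rightarrow> 'b) \<Rightarrow> 'a set \<Rightarrow> ('a \<Rightarrow> 'b) \<Rightarrow> bool" where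
  "dd_closed_op J J' S T \<longleftrightarrow> clinear_on J J' S T \<and> closure S = UNIV \<and>
     closed ((\<lambda>x. (x, T x)) ` S)"

definition bounded_clinear_J :: "('a::real_normed_vector \<Rightarrow> 'a) \<Rightarrow> ('b::real_normed_vector \<Rightarrow> 'b) \<Rightarrow> ('a \<Rightarrow> 'b) \<Rightarrow> bool" where
  "bounded_clinear_J J J' T \<longleftrightarrow> bounded_linear T \<and> (\<forall>x. T (J x) = J' (T x))"

definition adj_dom :: "('a::real_inner \<Rightarrow> 'a) \<Rightarrow> ('b::real_inner \<Rightarrow> 'b) \<Rightarrow> 'a set \<Rightarrow> ('a \<Rightarrow> 'b) \<Rightarrow> 'b set" where
  "adj_dom J J' S T = {y. \<exists>z. \<forall>x\<in>S. cinner J' (T x) y = cinner J x z}"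

definition adj :: "('a::real_inner \<Rightarrow> 'a) \<Rightarrow> ('b::real_inner \<Rightarrow> 'b) \<Rightarrow> 'a set \<Rightarrow> ('a \<Rightarrow> 'b) \<Rightarrow> 'b \<Rightarrow> 'a" where
  "adj J J' S T y = (THE z. \<forall>x\<in>S. cinner J' (T x) y = cinner J x z)"

definition ginner :: "('a::real_inner \<Rightarrow> 'a) \<Rightarrow> ('b::real_inner \<Rightarrow> 'b) \<Rightarrow> ('a \<Rightarrow> 'b) \<Rightarrow> 'a \<Rightarrow> 'a \<Rightarrow> complex" where
  "ginner J J' T u v = cinner J u v + cinner J' (T u) (T v)"

definition gnorm :: "('a::real_normed_vector \<Rightarrow> 'b::real_normed_vector) \<Rightarrow> 'a \<Rightarrow> real" where
  "gnorm T u = sqrt ((norm u)\<^sup>2 + (norm (T u))\<^sup>2)"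

text \<open>Note: dom(ring G) = dom(-D*) = adj_dom J1 J0 dD D and dom(ring D) = dom(-G*) = adj_dom J0 J1 dG G.\<close>

definition BDG :: "('a::real_inner \<Rightarrow> 'a) \<Rightarrow> ('b::real_inner \<Rightarrow> 'b) \<Rightarrow> 'a set \<Rightarrow> ('a \<Rightarrow> 'b) \<Rightarrow> 'b set \<Rightarrow> ('b \<Rightarrow> 'a) \<Rightarrow> 'a set" where
  "BDG J0 J1 dG G dD D = {u\<in>dG. \<forall>v\<in>adj_dom J1 J0 dD D. ginner J0 J1 G u v = 0}"

definition BDD :: "('a::real_inner \<Rightarrow> 'a) \<Rightarrow> ('b::real_inner \<Rightarrow> 'b) \<Rightarrow> 'a set \<Rightarrow> ('a \<Rightarrow> 'b) \<Rightarrow> 'b set \<Rightarrow> ('b \<Rightarrow> 'a) \<Rightarrow> 'b set" where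
  "BDD J0 J1 dG G dD D = {w\<in>dD. \<forall>v\<in>adj_dom J0 J1 dG G. ginner J1 J0 D w v = 0}"

definition proj_BDD :: "('a::real_inner \<Rightarrow> 'a) \<Rightarrow> ('b::real_inner \<Rightarrow> 'b) \<Rightarrow> 'a set \<Rightarrow> ('a \<Rightarrow> 'b) \<Rightarrow> 'b set \<Rightarrow> ('b \<Rightarrow> 'a) \<Rightarrow> 'b \<Rightarrow> 'b" where
  "proj_BDD J0 J1 dG G dD D w = (THE p. p \<in> BDD J0 J1 dG G dD D \<and>
      (\<forall>q\<in>BDD J0 J1 dG G dD D. ginner J1 J0 D (w - p) q = 0))"

definition bvp_sol :: "('a::real_inner \<Rightarrow> 'a) \<Rightarrow> ('b::real_inner \<Rightarrow> 'b) \<Rightarrow> 'a set \<Rightarrow> ('a \<Rightarrow> 'b) \<Rightarrow> 'b set \<Rightarrow> ('b \<Rightarrow> 'a)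
    \<Rightarrow> ('b \<Rightarrow> 'b) \<Rightarrow> ('a \<Rightarrow> 'a) \<Rightarrow> 'a \<Rightarrow> 'a" where
  "bvp_sol J0 J1 dG G dD D a m u0 = (THE u. u \<in> dG \<and> a (G u) \<in> dD \<and> m u - D (a (G u)) = 0 \<and>
      u - u0 \<in> adj_dom J1 J0 dD D)"

definition DtN :: "('a::real_inner \<Rightarrow> 'a) \<Rightarrow> ('b::real_inner \<Rightarrow> 'b) \<Rightarrow> 'a set \<Rightarrow> ('a \<Rightarrow> 'b) \<Rightarrow> 'b set \<Rightarrow> ('b \<Rightarrow> 'a)
    \<Rightarrow> ('b \<Rightarrow> 'b) \<Rightarrow> ('a \<Rightarrow> 'a) \<Rightarrow> 'a \<Rightarrow> 'b" where
  "DtN J0 J1 dG G dD D a m u0 = proj_BDD J0 J1 dG G dD D (a (G (bvp_sol J0 J1 dG G dD D a m u0)))"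

definition kappa_adj :: "('a::real_inner \<Rightarrow> 'a) \<Rightarrow> ('b::real_inner \<Rightarrow> 'b) \<Rightarrow> ('c::real_inner \<Rightarrow> 'c) \<Rightarrow> 'a set \<Rightarrow> ('a \<Rightarrow> 'b)
    \<Rightarrow> 'b set \<Rightarrow> ('b \<Rightarrow> 'a) \<Rightarrow> ('a \<Rightarrow> 'c) \<Rightarrow> 'c \<Rightarrow> 'a" where
  "kappa_adj J0 J1 JH dG G dD D \<kappa> \<psi> = (THE w. w \<in> BDG J0 J1 dG G dD D \<and>
      (\<forall>u\<in>BDG J0 J1 dG G dD D. cinner JH (\<kappa> u) \<psi> = ginner J0 J1 G u w))"

text \<open>The DtN operator Lambda_H in H as a relation: DtN_H phi psi iff phi in dom(Lambda_H) and
  Lambda_H phi = psi.\<close>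
definition DtN_H :: "('a::real_inner \<Rightarrow> 'a) \<Rightarrow> ('b::real_inner \<Rightarrow> 'b) \<Rightarrow> ('c::real_inner \<Rightarrow> 'c) \<Rightarrow> 'a set \<Rightarrow> ('a \<Rightarrow> 'b)
    \<Rightarrow> 'b set \<Rightarrow> ('b \<Rightarrow> 'a) \<Rightarrow> ('a \<Rightarrow> 'c) \<Rightarrow> ('b \<Rightarrow> 'b) \<Rightarrow> ('a \<Rightarrow> 'a) \<Rightarrow> 'c \<Rightarrow> 'c \<Rightarrow> bool" where
  "DtN_H J0 J1 JH dG G dD D \<kappa> a m \<phi> \<psi> \<longleftrightarrow>
     (\<exists>u0\<in>BDG J0 J1 dG G dD D. \<kappa> u0 = \<phi> \<and>
        DtN J0 J1 dG G dD D a m u0 = G (kappa_adj J0 J1 JH dG G dD D \<kappa> \<psi>))"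

definition DtN_H_inv :: "('a::real_inner \<Rightarrow> 'a) \<Rightarrow> ('b::real_inner \<Rightarrow> 'b) \<Rightarrow> ('c::real_inner \<Rightarrow> 'c) \<Rightarrow> 'a set \<Rightarrow> ('a \<Rightarrow> 'b)
    \<Rightarrow> 'b set \<Rightarrow> ('b \<Rightarrow> 'a) \<Rightarrow> ('a \<Rightarrow> 'c) \<Rightarrow> ('b \<Rightarrow> 'b) \<Rightarrow> ('a \<Rightarrow> 'a) \<Rightarrow> 'c \<Rightarrow> 'c" where
  "DtN_H_inv J0 J1 JH dG G dD D \<kappa> a m \<psi> = (THE \<phi>. DtN_H J0 J1 JH dG G dD D \<kappa> a m \<phi> \<psi>)"

text \<open>Orthogonal projection of H1 onto a closed subspace R (this is iota* for R = ran(G)).\<close>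
definition orth_proj :: "('b::real_inner \<Rightarrow> 'b) \<Rightarrow> 'b set \<Rightarrow> 'b \<Rightarrow> 'b" where
  "orth_proj J R y = (THE p. p \<in> R \<and> (\<forall>q\<in>R. cinner J (y - p) q = 0))"

definition compr_inv :: "('b::real_inner \<Rightarrow> 'b) \<Rightarrow> 'b set \<Rightarrow> ('b \<Rightarrow> 'b) \<Rightarrow> 'b \<Rightarrow> 'b" where
  "compr_inv J R a w = (THE v. v \<in> R \<and> orth_proj J R (a v) = w)"

end

theory Submission
  imports Defs
begin

text \<open>
  All inner product conditions range over complex subspaces, so they may be tested with the real
  inner product. The solution with Neumann datum \<open>\<psi>\<close> is the element \<open>x\<close> of the graph of \<open>G\<close> with
  \<open>(a G u, G v) + (m u, v) = (\<psi>, \<kappa> v)\<close> for all \<open>v \<in> dom(G)\<close>, where \<open>x = (u, G u)\<close> and \<open>\<kappa>\<close> is extended to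
  \<open>dom(G)\<close> by the orthogonal projection \<open>P\<close> onto \<open>BD(G)\<close>; hence \<open>\<Lambda>\<^sub>H\<inverse> = K S K\<^sup>*\<close> with \<open>K = \<kappa> P\<close> and \<open>S\<close> the
  Lax-Milgram solution operator. It then suffices that \<open>y\<^sub>n \<rightarrow> y\<close> implies \<open>S\<^sub>n y\<^sub>n \<rightarrow> S y\<close> weakly along a
  subsequence. If \<open>\<kappa>\<close> is compact, so are \<open>K\<close> and \<open>K\<^sup>*\<close>: the data \<open>K\<^sup>* \<psi>\<^sub>n\<close> of a bounded sequence
  converge along a subsequence, and \<open>K\<close> turns the weak convergence of the solutions into strong
  convergence.\<close>

section \<open>Closed subspaces of real Hilbert spaces\<close>

text \<open>The obstacle is that products of weakly convergent quantities need not converge, while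
  \<open>mn n\<close> and the gradients G u_n both converge only weakly. Every limit is therefore
  arranged as a weakly convergent operator acting on a strongly convergent argument. For the zero
  order term the argument is u_n itself, strongly convergent by the compact embedding. For the
  principal term the roles are exchanged: the flux, the projection of a_n G u_n onto ran(G), is
  shown to converge strongly, and G u_n is recovered from it by the inverse of the compression of
  a_n. This is why the hypothesis concerns these inverses and not a_n. The inverse of the
  Dirichlet-to-Neumann operator is the accessible object because prescribing Neumann data leaves all
  of dom(G) as trial and test space, independently of the data and of n.\<close>

lemma Cauchy_if_dist_power2_le:
  fixes x :: "nat \<Rightarrow> 'a::metric_space"
  assumes "e \<longlonglongrightarrow> 0" and le: "\<And>i j. (dist (x i) (x j))\<^sup>2 \<le> e i + e j"
  shows "Cauchy x"
  unfolding Cauchy_def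
proof (intro allI impI)
  fix r :: real assume r: "r > 0"
  then have "\<forall>\<^sub>F n in sequentially. e n < r\<^sup>2 / 2"
    using assms(1) order_tendstoD(2)[of e 0 sequentially "r\<^sup>2 / 2"] by simp
  then obtain M where M: "\<And>n. n \<ge> M \<Longrightarrow> e n < r\<^sup>2 / 2"
    by (auto simp: eventually_sequentially)
  have "dist (x i) (x j) < r" if "i \<ge> M" "j \<ge> M" for i j
  proof -
    have "(dist (x i) (x j))\<^sup>2 < r\<^sup>2"
      using le[of i j] M[OF that(1)] M[OF that(2)] by linarith
    then show ?thesis using r by (simp add: power_less_imp_less_base)
  qed
  then show "\<exists>M. \<forall>m\<ge>M. \<forall>n\<ge>M. dist (x m) (x n) < r" by blast
qed

text \<open>The representing vector minimises \<open>|v|\<^sup>2 - 2 f v\<close>; the parallelogram law makes minimising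
  sequences Cauchy.\<close>

lemma riesz_closed_subspace:
  fixes f :: "'a::{real_inner,complete_space} \<Rightarrow> real"
  assumes S: "subspace S" "closed S"
    and add: "\<And>x y. x \<in> S \<Longrightarrow> y \<in> S \<Longrightarrow> f (x + y) = f x + f y"
    and scale: "\<And>c x. x \<in> S \<Longrightarrow> f (c *\<^sub>R x) = c * f x"
    and bdd: "\<And>x. x \<in> S \<Longrightarrow> \<bar>f x\<bar> \<le> C * norm x"
  obtains w where "w \<in> S" "\<And>v. v \<in> S \<Longrightarrow> f v = inner w v"
proof -
  define F where "F v = inner v v - 2 * f v" for v
  define d where "d = Inf (F ` S)"
  have lower: "- C\<^sup>2 \<le> F v" if "v \<in> S" for v
  proof -
    have "F v \<ge> (norm v)\<^sup>2 - 2 * (C * norm v)"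
      using bdd[OF that] by (simp add: F_def power2_norm_eq_inner)
    moreover have "(norm v - C)\<^sup>2 \<ge> 0" by simp
    ultimately show ?thesis by (simp add: power2_diff algebra_simps)
  qed
  have bb: "bdd_below (F ` S)" using lower by (force intro: bdd_belowI)
  have S0: "0 \<in> S" using S by (simp add: subspace_0)
  have dle: "d \<le> F v" if "v \<in> S" for v
    unfolding d_def using that bb by (simp add: cINF_lower)
  have "\<exists>v\<in>S. F v < d + 1 / Suc n" for n
  proof -
    have "Inf (F ` S) < d + 1 / Suc n" unfolding d_def by simp
    then show ?thesis using S0 cInf_lessD[of "F ` S"] by blast
  qed
  then obtain x where xS: "\<And>n. x n \<in> S" and xF: "\<And>n. F (x n) < d + 1 / Suc n" by metis
  have par: "inner (u - v) (u - v) = 2 * F u + 2 * F v - 4 * F ((1/2) *\<^sub>R (u + v))"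
    if "u \<in> S" "v \<in> S" for u v
  proof -
    have "f ((1/2) *\<^sub>R (u + v)) = (f u + f v) / 2"
      using that S by (simp add: scale add subspace_add)
    then show ?thesis
      by (simp add: F_def inner_add inner_diff inner_commute algebra_simps)
  qed
  have "(dist (x i) (x j))\<^sup>2 \<le> 2 / Suc i + 2 / Suc j" for i j
  proof -
    have "(1/2) *\<^sub>R (x i + x j) \<in> S" using xS S by (simp add: subspace_add subspace_scale)
    then have "d \<le> F ((1/2) *\<^sub>R (x i + x j))" by (rule dle)
    then show ?thesis
      using par[OF xS xS, of i j] xF[of i] xF[of j]
      by (simp add: dist_norm power2_norm_eq_inner)
  qed
  moreover have "(\<lambda>n. 2 / real (Suc n)) \<longlonglongrightarrow> 0"
    using LIMSEQ_Suc[OF lim_const_over_n[of 2]] by simp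
  ultimately have "Cauchy x" using Cauchy_if_dist_power2_le by blast
  then obtain w where w: "x \<longlonglongrightarrow> w" using Cauchy_convergent convergent_def by blast
  have wS: "w \<in> S" using S(2) xS w closed_sequentially by blast
  have var: "d \<le> F w + (t\<^sup>2 * inner v v + 2 * t * (inner w v - f v))" if v: "v \<in> S" for t v
  proof -
    have "w + t *\<^sub>R v \<in> S" using wS v S by (simp add: subspace_add subspace_scale)
    then have "d \<le> F (w + t *\<^sub>R v)" by (rule dle)
    also have "F (w + t *\<^sub>R v) = F w + (t\<^sup>2 * inner v v + 2 * t * (inner w v - f v))"
      using wS v S by (simp add: F_def add scale subspace_scale inner_add inner_commute
          algebra_simps power2_eq_square)
    finally show ?thesis .
  qed
  have fx: "(\<lambda>n. f (x n)) \<longlonglongrightarrow> f w"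
  proof (rule Lim_null_comparison[THEN LIM_zero_cancel])
    have "f (x n - w) = f (x n) - f w" for n
      using add[of "x n" "-1 *\<^sub>R w"] scale[of w "-1"] xS[of n] wS S
      by (simp add: subspace_scale subspace_neg)
    then show "\<forall>\<^sub>F n in sequentially. norm (f (x n) - f w) \<le> C * norm (x n - w)"
      using bdd xS wS S by (intro always_eventually) (metis real_norm_def subspace_diff)
    show "(\<lambda>n. C * norm (x n - w)) \<longlonglongrightarrow> 0"
      using w by (intro tendsto_mult_right_zero tendsto_norm_zero LIM_zero)
  qed
  have "(\<lambda>n. F (x n)) \<longlonglongrightarrow> F w"
    unfolding F_def by (intro tendsto_intros w fx)
  moreover have "(\<lambda>n. d + 1 / real (Suc n)) \<longlonglongrightarrow> d + 0"
    by (intro tendsto_intros LIMSEQ_Suc[OF lim_const_over_n])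
  ultimately have "F w \<le> d + 0"
    using xF by (intro LIMSEQ_le) (auto intro: less_imp_le)
  then have var': "0 \<le> t\<^sup>2 * inner v v + 2 * t * (inner w v - f v)" if "v \<in> S" for t v
    using var[OF that, of t] by simp
  have "f v = inner w v" if v: "v \<in> S" for v
  proof -
    define b where "b = inner w v - f v"
    \<comment> \<open>The step minimising the quadratic in t is -b / |v|^2; adding 1 to the
      denominator keeps it positive for v = 0 and still gives a contradiction unless b = 0.\<close>
    define c where "c = inner v v + 1"
    have c: "c > 0" by (simp add: c_def add_nonneg_pos)
    have "0 \<le> (- b / c)\<^sup>2 * inner v v + 2 * (- b / c) * b"
      using var'[OF v, of "- b / c"] by (simp add: b_def)
    also have "\<dots> \<le> (b / c)\<^sup>2 * c - 2 * (b / c) * b"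
      by (simp add: c_def mult_left_mono)
    also have "\<dots> = - (b\<^sup>2 / c)"
      using c by (simp add: power2_eq_square field_simps)
    finally have "b\<^sup>2 \<le> 0" using c by (simp add: divide_le_0_iff)
    then show ?thesis by (simp add: b_def)
  qed
  then show ?thesis using that wS by blast
qed

definition oproj :: "'a::real_inner set \<Rightarrow> 'a \<Rightarrow> 'a" where
  "oproj S x = (THE p. p \<in> S \<and> (\<forall>q\<in>S. inner (x - p) q = 0))"

lemma oproj_eqI:
  assumes "subspace S" "p \<in> S" "\<And>q. q \<in> S \<Longrightarrow> inner (x - p) q = 0"
  shows "oproj S x = p"
  unfolding oproj_def
proof (rule the_equality)
  show "p \<in> S \<and> (\<forall>q\<in>S. inner (x - p) q = 0)" using assms by blast
next
  fix p' assume p': "p' \<in> S \<and> (\<forall>q\<in>S. inner (x - p') q = 0)"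
  then have "p' - p \<in> S" using assms by (simp add: subspace_diff)
  then have "inner (x - p) (p' - p) - inner (x - p') (p' - p) = 0" using assms p' by auto
  then have "inner (p' - p) (p' - p) = 0" by (simp add: inner_diff algebra_simps)
  then show "p' = p" by simp
qed

context
  fixes S :: "'a::{real_inner,complete_space} set"
  assumes S: "subspace S" "closed S"
begin

lemma oproj_props: "oproj S x \<in> S \<and> (\<forall>q\<in>S. inner (x - oproj S x) q = 0)"
proof -
  obtain p where "p \<in> S" "\<And>q. q \<in> S \<Longrightarrow> inner x q = inner p q"
    using riesz_closed_subspace[OF S, of "inner x" "norm x"]
    by (auto simp: inner_add Cauchy_Schwarz_ineq2)
  then have "p \<in> S" "\<And>q. q \<in> S \<Longrightarrow> inner (x - p) q = 0" by (auto simp: inner_diff_left)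
  then show ?thesis using oproj_eqI[OF S(1), of p x] by simp
qed

lemma oproj_in: "oproj S x \<in> S"
  using oproj_props by blast

lemma oproj_inner: "q \<in> S \<Longrightarrow> inner (oproj S x) q = inner x q"
  using oproj_props[of x] by (auto simp: inner_diff_left)

lemma oproj_id: "x \<in> S \<Longrightarrow> oproj S x = x"
  by (rule oproj_eqI[OF S(1)]) auto

lemma oproj_self_adjoint: "inner (oproj S x) y = inner x (oproj S y)"
  by (metis inner_commute oproj_in oproj_inner)

lemma diff_oproj_in_comp: "x - oproj S x \<in> S\<^sup>\<bottom>"
  using oproj_props[of x] by (auto simp: orthogonal_comp_def orthogonal_def inner_commute)

lemma norm_oproj_le: "norm (oproj S x) \<le> norm x"
proof -
  have "(norm (oproj S x))\<^sup>2 = inner x (oproj S x)"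
    by (simp add: power2_norm_eq_inner oproj_in oproj_inner)
  also have "\<dots> \<le> norm x * norm (oproj S x)" by (rule norm_cauchy_schwarz)
  finally show ?thesis by (cases "oproj S x = 0") (auto simp: power2_eq_square)
qed

lemma bounded_linear_oproj: "bounded_linear (oproj S)"
proof (rule bounded_linear_intro[where K = 1])
  show "oproj S (x + y) = oproj S x + oproj S y" for x y
    by (rule oproj_eqI[OF S(1)])
      (use S(1) in \<open>auto simp: inner_add inner_diff oproj_in oproj_inner subspace_add\<close>)
  show "oproj S (r *\<^sub>R x) = r *\<^sub>R oproj S x" for r x
    by (rule oproj_eqI[OF S(1)])
      (use S(1) in \<open>auto simp: inner_diff oproj_in oproj_inner subspace_scale\<close>)
  show "norm (oproj S x) \<le> norm x * 1" for x by (simp add: norm_oproj_le)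
qed

lemma orthogonal_comp_comp: "S\<^sup>\<bottom>\<^sup>\<bottom> = S"
proof
  show "S\<^sup>\<bottom>\<^sup>\<bottom> \<subseteq> S"
  proof
    fix x assume x: "x \<in> S\<^sup>\<bottom>\<^sup>\<bottom>"
    let ?r = "x - oproj S x"
    have "inner ?r x = 0"
      using x diff_oproj_in_comp[of x] unfolding orthogonal_comp_def orthogonal_def by blast
    moreover have "inner ?r (oproj S x) = 0" using oproj_props[of x] by blast
    ultimately have "inner ?r ?r = 0" by (simp only: inner_diff_right)
    then show "x \<in> S" using oproj_in[of x] by simp
  qed
qed (rule orthogonal_comp_subset)

text \<open>Orthogonality to a fixed vector survives weak limits, and a closed subspace is its own
  double complement.\<close>

lemma weak_limit_in_closed_subspace:
  assumes "\<And>n. x n \<in> S" and w: "\<And>h. (\<lambda>n. inner (x n) h) \<longlonglongrightarrow> inner l h"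
  shows "l \<in> S"
proof -
  have "(\<lambda>n. inner (x n) h) = (\<lambda>n. 0)" if "h \<in> S\<^sup>\<bottom>" for h
    using assms(1) that by (auto simp: orthogonal_comp_def orthogonal_def)
  then have "inner l h = 0" if "h \<in> S\<^sup>\<bottom>" for h
    using w[of h] that LIMSEQ_unique by (metis tendsto_const)
  then have "l \<in> S\<^sup>\<bottom>\<^sup>\<bottom>" by (auto simp: orthogonal_comp_def orthogonal_def inner_commute)
  then show ?thesis by (simp add: orthogonal_comp_comp)
qed

text \<open>Solutions are the fixed points in \<open>S\<close> of the relaxed iteration x - r (A x -
  y) followed by projection onto \<open>S\<close>. Coercivity makes it a contraction for a suitable
  r, so Banach's theorem gives existence and uniqueness together.\<close>

lemma lax_milgram:
  assumes A: "bounded_linear A" and c: "c > 0"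
    and coer: "\<And>x. inner (A x) x \<ge> c * (norm x)\<^sup>2"
  shows "\<exists>!x. x \<in> S \<and> (\<forall>v\<in>S. inner (A x) v = inner y v)"
proof -
  interpret A: bounded_linear A by (rule A)
  interpret P: bounded_linear "oproj S" by (rule bounded_linear_oproj)
  obtain C where C: "C > 0" "\<And>x. norm (A x) \<le> norm x * C" using A.pos_bounded by blast
  \<comment> \<open>A bound for \<open>A\<close> that also dominates \<open>c\<close>, which keeps 1
    - (c / b)^2 nonnegative.\<close>
  define b where "b = c + C"
  have b: "b > 0" "C \<le> b" "c \<le> b" using c C by (auto simp: b_def)
  \<comment> \<open>This value minimises 1 - 2 r c + r^2 b^2; the minimum 1 - (c / b)^2 is the
    square of \<open>k\<close> below.\<close>
  define r where "r = c / b\<^sup>2"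
  have r: "r > 0" using b c by (simp add: r_def)
  define f where "f x = oproj S (x - r *\<^sub>R (A x - y))" for x
  define k where "k = sqrt (1 - (c / b)\<^sup>2)"
  have cb: "(c / b)\<^sup>2 \<le> 1" "(c / b)\<^sup>2 > 0" using b c by (auto simp: power_le_one)
  have "\<exists>!x\<in>S. f x = x"
  proof (rule Banach_fix[where c = k])
    show "complete S" using S(2) by (simp add: complete_eq_closed)
    show "S \<noteq> {}" using S(1) subspace_0 by blast
    show "0 \<le> k" "k < 1" using cb by (simp_all add: k_def)
    show "f ` S \<subseteq> S" by (auto simp: f_def oproj_in)
    fix x z :: 'a
    define w where "w = x - z"
    have "f x - f z = oproj S ((x - r *\<^sub>R (A x - y)) - (z - r *\<^sub>R (A z - y)))"
      by (simp only: f_def P.diff)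
    also have "(x - r *\<^sub>R (A x - y)) - (z - r *\<^sub>R (A z - y)) = w - r *\<^sub>R A w"
      by (simp add: w_def A.diff scaleR_diff_right)
    finally have "norm (f x - f z) \<le> norm (w - r *\<^sub>R A w)" by (simp add: norm_oproj_le)
    moreover have "(norm (w - r *\<^sub>R A w))\<^sup>2 \<le> (k * norm w)\<^sup>2"
    proof -
      have "(norm (A w))\<^sup>2 \<le> (b * norm w)\<^sup>2"
        using C(2)[of w] mult_left_mono[OF b(2), of "norm w"]
        by (intro power_mono) (simp_all add: mult.commute)
      then have "r\<^sup>2 * (norm (A w))\<^sup>2 \<le> r\<^sup>2 * (b\<^sup>2 * (norm w)\<^sup>2)"
        by (simp add: mult_left_mono power_mult_distrib)
      moreover have "2 * r * (c * (norm w)\<^sup>2) \<le> 2 * r * inner (A w) w"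
        using coer[of w] r by (simp add: mult_left_mono)
      moreover have "(norm (w - r *\<^sub>R A w))\<^sup>2 = (norm w)\<^sup>2 - 2 * r * inner (A w) w + r\<^sup>2 * (norm (A w))\<^sup>2"
        unfolding power2_norm_eq_inner
        by (simp add: inner_diff inner_commute[of w "A w"] power2_eq_square algebra_simps)
      moreover have "r\<^sup>2 * b\<^sup>2 = (c / b)\<^sup>2" "r * c = (c / b)\<^sup>2"
        using b by (simp_all add: r_def power2_eq_square)
      then have "r\<^sup>2 * (b\<^sup>2 * (norm w)\<^sup>2) = (c / b)\<^sup>2 * (norm w)\<^sup>2"
        "2 * r * (c * (norm w)\<^sup>2) = 2 * ((c / b)\<^sup>2 * (norm w)\<^sup>2)"
        by (metis mult.assoc)+
      moreover have "(k * norm w)\<^sup>2 = (norm w)\<^sup>2 - (c / b)\<^sup>2 * (norm w)\<^sup>2"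
        using cb by (simp add: k_def power_mult_distrib left_diff_distrib)
      ultimately show ?thesis by linarith
    qed
    then have "norm (w - r *\<^sub>R A w) \<le> k * norm w"
      by (rule power2_le_imp_le) (use cb in \<open>simp add: k_def\<close>)
    ultimately show "dist (f x) (f z) \<le> k * dist x z" by (simp add: dist_norm w_def)
  qed
  moreover have "f x = x \<longleftrightarrow> (\<forall>v\<in>S. inner (A x) v = inner y v)" if x: "x \<in> S" for x
  proof
    assume "f x = x"
    then have "inner (x - r *\<^sub>R (A x - y)) v = inner x v" if "v \<in> S" for v
      using that oproj_inner[of v "x - r *\<^sub>R (A x - y)"] by (simp add: f_def)
    then show "\<forall>v\<in>S. inner (A x) v = inner y v"
      using r by (simp add: inner_diff)
  next
    assume "\<forall>v\<in>S. inner (A x) v = inner y v"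
    then show "f x = x"
      unfolding f_def by (intro oproj_eqI[OF S(1) x]) (simp add: inner_diff)
  qed
  ultimately show ?thesis by (auto simp: Ex1_def)
qed

end

lemma in_orthogonal_comp_iff: "x \<in> S\<^sup>\<bottom> \<longleftrightarrow> (\<forall>y\<in>S. inner x y = 0)"
  by (auto simp: orthogonal_comp_def orthogonal_def inner_commute)

lemma closed_orthogonal_comp: "closed (S\<^sup>\<bottom>)"
proof -
  have "S\<^sup>\<bottom> = (\<Inter>y\<in>S. {x. inner y x = 0})" by (auto simp: orthogonal_comp_def orthogonal_def)
  then show ?thesis by (auto intro!: closed_INT closed_Collect_eq continuous_intros)
qed

lemma bounded_adjoint_exists:
  fixes T :: "'a::{real_inner,complete_space} \<Rightarrow> 'b::real_inner"
  assumes T: "bounded_linear T"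
  obtains T' where "bounded_linear T'" "\<And>x y. inner (T x) y = inner x (T' y)"
proof -
  interpret T: bounded_linear T by (rule T)
  obtain C where C: "\<And>x. norm (T x) \<le> norm x * C" "C \<ge> 0" using T.nonneg_bounded by blast
  have "\<exists>w. \<forall>x. inner (T x) y = inner x w" for y
  proof (rule riesz_closed_subspace[of UNIV "\<lambda>x. inner (T x) y" "C * norm y"])
    show "\<bar>inner (T x) y\<bar> \<le> C * norm y * norm x" for x
      using Cauchy_Schwarz_ineq2[of "T x" y] mult_right_mono[OF C(1)[of x], of "norm y"]
      by (simp add: mult_ac)
  qed (auto simp: T.add T.scaleR inner_add inner_commute)
  then obtain T' where T': "\<And>x y. inner (T x) y = inner x (T' y)" by metis
  have "bounded_linear T'"
  proof (rule bounded_linear_intro[where K = C])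
    show "T' (x + y) = T' x + T' y" for x y
      by (subst vector_eq_rdot[symmetric])
        (metis T' inner_commute inner_add_right)
    show "T' (c *\<^sub>R x) = c *\<^sub>R T' x" for c x
      by (subst vector_eq_rdot[symmetric])
        (metis T' inner_commute inner_scaleR_right)
    show "norm (T' y) \<le> norm y * C" for y
    proof (cases "T' y = 0")
      case False
      have "norm (T' y) * norm (T' y) = inner (T (T' y)) y"
        unfolding T' by (simp add: dot_square_norm power2_eq_square)
      also have "\<dots> \<le> norm (T (T' y)) * norm y" by (rule norm_cauchy_schwarz)
      also have "\<dots> \<le> norm (T' y) * C * norm y" by (intro mult_right_mono C) simp
      finally show ?thesis using False by (simp add: mult_ac)
    qed (use C in simp)
  qed
  with T' that show ?thesis by blast
qed

section \<open>Weak convergence, uniform boundedness and compactness\<close>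

text \<open>Baire: the closed sets \<open>F N\<close> cover the space, so one of them contains a
  ball, and on that ball all operators share the bound N.\<close>

lemma uniform_boundedness:
  fixes T :: "'i \<Rightarrow> 'a::{real_normed_vector,complete_space} \<Rightarrow> 'b::real_normed_vector"
  assumes T: "\<And>i. bounded_linear (T i)" and pt: "\<And>x. \<exists>C. \<forall>i. norm (T i x) \<le> C"
  obtains C where "\<And>i x. norm (T i x) \<le> C * norm x"
proof -
  define F where "F N = {x. \<forall>i. norm (T i x) \<le> real N}" for N :: nat
  have F: "closed (F N)" for N
  proof -
    have "F N = (\<Inter>i. {x. norm (T i x) \<le> real N})" by (auto simp: F_def)
    then show ?thesis
      by (auto intro!: closed_INT closed_Collect_le continuous_intros
          linear_continuous_on[OF T])
  qed
  have "(\<Union>N. F N) = UNIV"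
  proof safe
    fix x
    obtain C where C: "\<forall>i. norm (T i x) \<le> C" using pt by blast
    obtain N where "C \<le> real N" using real_arch_simple by blast
    then have "x \<in> F N" using C order_trans unfolding F_def by blast
    then show "x \<in> (\<Union>N. F N)" by blast
  qed simp
  have "\<exists>N. interior (F N) \<noteq> {}"
  proof (rule ccontr)
    assume "\<nexists>N. interior (F N) \<noteq> {}"
    then have "(euclidean :: 'a topology) interior_of \<Union>(range F) = {}"
      by (intro Baire_category_alt) (use F in \<open>auto simp: completely_metrizable_space_euclidean\<close>)
    with \<open>(\<Union>N. F N) = UNIV\<close> show False by simp
  qed
  then obtain N z where "z \<in> interior (F N)" by blast
  then obtain e where e: "e > 0" "cball z e \<subseteq> F N"
    by (meson interior_subset mem_interior_cball order_trans)
  have "norm (T i x) \<le> (2 * real N / e) * norm x" for i x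
  proof (cases "x = 0")
    case True
    then show ?thesis by (simp add: linear_0 T bounded_linear.linear)
  next
    case False
    interpret T: bounded_linear "T i" by (rule T)
    \<comment> \<open>Rescaling to norm e keeps z + y in the ball. The image of y is then a
      difference of two vectors of norm at most N, whence the constant 2 N / e.\<close>
    define y where "y = (e / norm x) *\<^sub>R x"
    have "z + y \<in> F N" "z \<in> F N" using e False by (auto simp: y_def dist_norm subset_iff)
    then have "norm (T i (z + y)) \<le> N" "norm (T i z) \<le> N" by (auto simp: F_def)
    then have "norm (T i (z + y) - T i z) \<le> 2 * real N"
      using norm_triangle_ineq4[of "T i (z + y)" "T i z"] by linarith
    then have "norm (T i y) \<le> 2 * real N" by (simp add: T.add)
    then show ?thesis using e False by (simp add: y_def T.scaleR field_simps)
  qed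
  then show ?thesis using that by blast
qed

text \<open>Uniform boundedness for the functionals h -> (x_n, h), whose bound is then evaluated at
  h = x_n.\<close>

lemma weakly_convergent_bounded:
  fixes x :: "nat \<Rightarrow> 'a::{real_inner,complete_space}"
  assumes "\<And>h. convergent (\<lambda>n. inner (x n) h)"
  obtains C where "\<And>n. norm (x n) \<le> C"
proof -
  obtain C where C: "\<And>i h. norm (inner (x i) h) \<le> C * norm h"
  proof (rule uniform_boundedness[of "\<lambda>i. inner (x i)"])
    show "bounded_linear (inner (x i))" for i by (rule bounded_linear_inner_right)
    show "\<exists>C. \<forall>i. norm (inner (x i) h) \<le> C" for h
      using convergent_imp_Bseq[OF assms[of h]] by (auto simp: Bseq_def)
  qed blast
  have "norm (x n) \<le> \<bar>C\<bar>" for n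
  proof (cases "x n = 0")
    case False
    have "norm (x n) * norm (x n) \<le> C * norm (x n)"
      using C[of n "x n"] by (simp add: dot_square_norm power2_eq_square)
    then show ?thesis using False by simp
  qed simp
  then show ?thesis using that by blast
qed

text \<open>Compactness only ever yields subsequences. If f failed to converge, the indices keeping
  a distance e from l would form an infinite set, whose enumeration has no subsequence converging to
  l.\<close>

lemma tendsto_if_subsequences:
  fixes f :: "nat \<Rightarrow> 'a::metric_space"
  assumes "\<And>r :: nat \<Rightarrow> nat. strict_mono r \<Longrightarrow> \<exists>s. strict_mono s \<and> (\<lambda>n. f (r (s n))) \<longlonglongrightarrow> l"
  shows "f \<longlonglongrightarrow> l"
proof (rule ccontr)
  assume "\<not> f \<longlonglongrightarrow> l"
  then obtain e where e: "e > 0" "\<exists>\<^sub>F n in sequentially. \<not> dist (f n) l < e"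
    by (auto simp: tendsto_iff not_eventually)
  then have inf: "infinite {n. \<not> dist (f n) l < e}"
    by (simp add: frequently_cofinite cofinite_eq_sequentially[symmetric])
  define r where "r = enumerate {n. \<not> dist (f n) l < e}"
  have r: "strict_mono r" "\<And>n. \<not> dist (f (r n)) l < e"
    using strict_mono_enumerate[OF inf] enumerate_in_set[OF inf] by (auto simp: r_def)
  then obtain s where "(\<lambda>n. f (r (s n))) \<longlonglongrightarrow> l" using assms by blast
  then have "\<forall>\<^sub>F n in sequentially. dist (f (r (s n))) l < e" using e(1) by (rule tendstoD)
  then show False using r(2) by (auto simp: eventually_sequentially)
qed

lemma tendsto_inner_weak_strong:
  fixes x y :: "nat \<Rightarrow> 'a::real_inner"
  assumes x: "\<And>h. (\<lambda>n. inner (x n) h) \<longlonglongrightarrow> inner l h" and bdd: "\<And>n. norm (x n) \<le> C"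
    and y: "y \<longlonglongrightarrow> k"
  shows "(\<lambda>n. inner (x n) (y n)) \<longlonglongrightarrow> inner l k"
proof -
  have "(\<lambda>n. inner (x n) (y n - k)) \<longlonglongrightarrow> 0"
  proof (rule Lim_null_comparison)
    have "norm (inner (x n) (y n - k)) \<le> C * norm (y n - k)" for n
      using Cauchy_Schwarz_ineq2[of "x n" "y n - k"] mult_right_mono[OF bdd[of n], of "norm (y n - k)"]
      by simp
    then show "\<forall>\<^sub>F n in sequentially. norm (inner (x n) (y n - k)) \<le> C * norm (y n - k)" by simp
    show "(\<lambda>n. C * norm (y n - k)) \<longlonglongrightarrow> 0"
      using y by (intro tendsto_mult_right_zero tendsto_norm_zero LIM_zero)
  qed
  from tendsto_add[OF this x[of k]] show ?thesis by (simp add: inner_diff_right)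
qed

text \<open>Testing against \<open>S\<close> alone is enough: the pointwise limit is a linear
  functional on \<open>S\<close> bounded by C, and Riesz represents it inside
  \<open>S\<close>.\<close>

lemma weak_limit_exists:
  fixes x :: "nat \<Rightarrow> 'a::{real_inner,complete_space}"
  assumes S: "subspace S" "closed S"
    and conv: "\<And>h. h \<in> S \<Longrightarrow> convergent (\<lambda>n. inner (x n) h)" and bdd: "\<And>n. norm (x n) \<le> C"
  obtains l where "l \<in> S" "\<And>h. h \<in> S \<Longrightarrow> (\<lambda>n. inner (x n) h) \<longlonglongrightarrow> inner l h"
proof -
  define f where "f h = lim (\<lambda>n. inner (x n) h)" for h
  have f: "(\<lambda>n. inner (x n) h) \<longlonglongrightarrow> f h" if "h \<in> S" for h
    using conv[OF that] by (simp add: f_def convergent_LIMSEQ_iff)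
  obtain l where "l \<in> S" "\<And>h. h \<in> S \<Longrightarrow> f h = inner l h"
  proof (rule riesz_closed_subspace[OF S])
    show "f (h + k) = f h + f k" if "h \<in> S" "k \<in> S" for h k
      using tendsto_add[OF f f, OF that] f[of "h + k"] that S(1)
      by (auto simp: subspace_add inner_add_right intro: LIMSEQ_unique)
    show "f (c *\<^sub>R h) = c * f h" if "h \<in> S" for c h
      using tendsto_mult_left[OF f, OF that, of c] f[of "c *\<^sub>R h"] that S(1)
      by (auto simp: subspace_scale intro: LIMSEQ_unique)
    show "\<bar>f h\<bar> \<le> C * norm h" if "h \<in> S" for h
    proof (rule LIMSEQ_le_const2[OF tendsto_rabs[OF f[OF that]]])
      have "\<bar>inner (x n) h\<bar> \<le> C * norm h" for n
        using Cauchy_Schwarz_ineq2[of "x n" h] mult_right_mono[OF bdd[of n], of "norm h"] by simp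
      then show "\<exists>N. \<forall>n\<ge>N. \<bar>inner (x n) h\<bar> \<le> C * norm h" by blast
    qed
  qed blast
  then show ?thesis using that f by metis
qed

text \<open>Stated relative to a subspace so that it serves both the first projection on the graph
  of G and, with \<open>S = UNIV\<close>, the boundary map.\<close>

lemma compact_image_subsequence:
  fixes x :: "nat \<Rightarrow> 'a::real_normed_vector" and T :: "'a \<Rightarrow> 'b::real_normed_vector"
  assumes T: "bounded_linear T" and S: "subspace S" and c: "compact (closure (T ` (S \<inter> cball 0 1)))"
    and x: "\<And>n. x n \<in> S" "\<And>n. norm (x n) \<le> C"
  obtains r l where "strict_mono r" "(\<lambda>n. T (x (r n))) \<longlonglongrightarrow> l"
proof -
  interpret T: bounded_linear T by (rule T)
  \<comment> \<open>Any bound for the sequence that is strictly positive, so that dividing by it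
    moves the sequence into the unit ball.\<close>
  define D where "D = \<bar>C\<bar> + 1"
  have "norm (x n) \<le> D" for n using x(2)[of n] by (simp add: D_def)
  then have D: "D > 0" "\<And>n. norm (x n) \<le> D" by (auto simp: D_def)
  have "x n /\<^sub>R D \<in> S \<inter> cball 0 1" for n
    using x(1) D(1) D(2)[of n] S by (simp add: subspace_scale field_simps)
  then have "T (x n /\<^sub>R D) \<in> closure (T ` (S \<inter> cball 0 1))" for n
    using closure_subset by blast
  then obtain l r where "strict_mono r" "((\<lambda>n. T (x n /\<^sub>R D)) \<circ> r) \<longlonglongrightarrow> l"
    using c[unfolded compact_def] by (metis (no_types, lifting))
  then have "(\<lambda>n. D *\<^sub>R T (x (r n) /\<^sub>R D)) \<longlonglongrightarrow> D *\<^sub>R l"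
    by (intro tendsto_scaleR tendsto_const) (simp add: o_def)
  then have "(\<lambda>n. T (x (r n))) \<longlonglongrightarrow> D *\<^sub>R l" using D(1) by (simp add: T.scaleR)
  with that \<open>strict_mono r\<close> show ?thesis by blast
qed

section \<open>Variational problems on a closed subspace with compact first projection\<close>

text \<open>As \<open>inner\<close> is the real part of \<open>cinner\<close>, this expresses Re A
  \<ge> \<mu>.\<close>

definition coercive :: "real \<Rightarrow> ('a::real_inner \<Rightarrow> 'a) \<Rightarrow> bool" where
  "coercive \<mu> A \<longleftrightarrow> \<mu> > 0 \<and> bounded_linear A \<and> (\<forall>x. \<mu> * (norm x)\<^sup>2 \<le> inner (A x) x)"

lemma coercive_map_prod:
  assumes "coercive \<mu> A" "coercive \<mu> B"
  shows "coercive \<mu> (map_prod A B)"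
proof -
  have "bounded_linear (\<lambda>x. (A (fst x), B (snd x)))"
    using assms by (intro bounded_linear_Pair bounded_linear_compose[OF _ bounded_linear_fst]
        bounded_linear_compose[OF _ bounded_linear_snd]) (auto simp: coercive_def)
  moreover have "map_prod A B = (\<lambda>x. (A (fst x), B (snd x)))" by auto
  moreover have "\<mu> * (norm x)\<^sup>2 \<le> inner (map_prod A B x) x" for x
  proof -
    have "\<mu> * (norm (fst x))\<^sup>2 \<le> inner (A (fst x)) (fst x)"
      "\<mu> * (norm (snd x))\<^sup>2 \<le> inner (B (snd x)) (snd x)"
      using assms by (auto simp: coercive_def)
    then show ?thesis
      by (cases x) (simp add: norm_Pair distrib_left)
  qed
  ultimately show ?thesis using assms by (simp add: coercive_def)
qed

text \<open>The Lax-Milgram solution operator: the inverse of the compression of A to S, preceded by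
  the projection onto S. It is used twice, with the graph of G for the boundary value problem and
  with ran(G) for the inverse of the compression of a.\<close>

definition galerkin :: "'a::real_inner set \<Rightarrow> ('a \<Rightarrow> 'a) \<Rightarrow> 'a \<Rightarrow> 'a" where
  "galerkin S A y = (THE x. x \<in> S \<and> (\<forall>v\<in>S. inner (A x) v = inner y v))"

context
  fixes S :: "'a::{real_inner,complete_space} set" and A :: "'a \<Rightarrow> 'a" and \<mu> :: real
  assumes S: "subspace S" "closed S" and A: "coercive \<mu> A"
begin

lemma galerkin_ex1: "\<exists>!x. x \<in> S \<and> (\<forall>v\<in>S. inner (A x) v = inner y v)"
  using A by (intro lax_milgram[OF S, of A \<mu>]) (auto simp: coercive_def)

lemma galerkin_in: "galerkin S A y \<in> S"
  and galerkin_inner: "v \<in> S \<Longrightarrow> inner (A (galerkin S A y)) v = inner y v"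
  using theI'[OF galerkin_ex1[of y]] unfolding galerkin_def by blast+

lemma galerkin_eqI: "x \<in> S \<Longrightarrow> (\<And>v. v \<in> S \<Longrightarrow> inner (A x) v = inner y v) \<Longrightarrow> galerkin S A y = x"
  using galerkin_ex1[of y] galerkin_in[of y] galerkin_inner[of _ y] by blast

lemma norm_galerkin_le: "norm (galerkin S A y) \<le> norm y / \<mu>"
proof -
  let ?x = "galerkin S A y"
  have \<mu>: "\<mu> > 0" using A by (simp add: coercive_def)
  have "\<mu> * (norm ?x)\<^sup>2 \<le> inner (A ?x) ?x" using A by (simp add: coercive_def)
  also have "\<dots> = inner y ?x" by (intro galerkin_inner galerkin_in)
  also have "\<dots> \<le> norm y * norm ?x" by (rule norm_cauchy_schwarz)
  finally have "norm ?x * (norm ?x * \<mu>) \<le> norm ?x * norm y"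
    by (simp add: power2_eq_square mult_ac)
  then show ?thesis using \<mu> by (cases "?x = 0") (auto simp: pos_le_divide_eq)
qed

lemma bounded_linear_galerkin: "bounded_linear (galerkin S A)"
proof (rule bounded_linear_intro[where K = "1 / \<mu>"])
  interpret A: bounded_linear A using A by (simp add: coercive_def)
  show "galerkin S A (x + y) = galerkin S A x + galerkin S A y" for x y
    by (rule galerkin_eqI)
      (use S(1) in \<open>auto simp: A.add inner_add galerkin_inner galerkin_in subspace_add\<close>)
  show "galerkin S A (c *\<^sub>R x) = c *\<^sub>R galerkin S A x" for c x
    by (rule galerkin_eqI)
      (use S(1) in \<open>auto simp: A.scaleR galerkin_inner galerkin_in subspace_scale\<close>)
  show "norm (galerkin S A x) \<le> norm x * (1 / \<mu>)" for x using norm_galerkin_le[of x] by simp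
qed

end

section \<open>Graphs with compact first projection: Poincare inequality and closed range\<close>

locale compact_graph =
  fixes \<Gamma> :: "('a::{real_inner,complete_space} \<times> 'b::{real_inner,complete_space}) set"
  assumes subspace_graph: "subspace \<Gamma>" and closed_graph: "closed \<Gamma>"
    and compact_fst: "compact (closure (fst ` (\<Gamma> \<inter> cball 0 1)))"
begin

definition kernel :: "'a set" where "kernel = {v. (v, 0) \<in> \<Gamma>}"

lemma subspace_kernel: "subspace kernel"
  unfolding subspace_def kernel_def
  using subspace_0[OF subspace_graph] subspace_add[OF subspace_graph] subspace_scale[OF subspace_graph]
  by (force simp: zero_prod_def)

lemma closed_kernel: "closed kernel"
proof -
  have "kernel = (\<lambda>v. (v, 0)) -` \<Gamma>" by (auto simp: kernel_def)
  then show ?thesis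
    by (simp only:) (intro closed_vimage closed_graph continuous_on_Pair continuous_on_id continuous_on_const)
qed

text \<open>Otherwise there are unit vectors orthogonal to the kernel whose images tend to zero. By
  compactness a subsequence converges strongly, and its limit has norm one yet lies in the kernel
  and in its complement.\<close>

lemma poincare: "\<exists>C\<ge>0. \<forall>v r. (v, r) \<in> \<Gamma> \<longrightarrow> v \<in> kernel\<^sup>\<bottom> \<longrightarrow> norm v \<le> C * norm r"
proof (rule ccontr)
  assume no: "\<not> ?thesis"
  have "\<exists>x. x \<in> \<Gamma> \<and> fst x \<in> kernel\<^sup>\<bottom> \<and> norm (fst x) = 1 \<and> norm (snd x) \<le> 1 / Suc n" for n
  proof -
    obtain v r where vr: "(v, r) \<in> \<Gamma>" "v \<in> kernel\<^sup>\<bottom>" "norm v > Suc n * norm r"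
      using no by (metis not_le of_nat_0_le_iff)
    have v0: "norm v > 0" using vr(3) by (smt (verit) mult_nonneg_nonneg norm_ge_zero of_nat_0_le_iff)
    show ?thesis
    proof (intro exI conjI)
      show "(1 / norm v) *\<^sub>R (v, r) \<in> \<Gamma>" using vr subspace_graph by (simp only: subspace_scale)
      show "fst ((1 / norm v) *\<^sub>R (v, r)) \<in> kernel\<^sup>\<bottom>"
        using vr by (simp add: subspace_scale subspace_orthogonal_comp)
      show "norm (fst ((1 / norm v) *\<^sub>R (v, r))) = 1" using v0 by simp
      show "norm (snd ((1 / norm v) *\<^sub>R (v, r))) \<le> 1 / Suc n"
        using v0 vr(3) by (simp add: field_simps)
    qed
  qed
  then obtain x where x: "\<And>n. x n \<in> \<Gamma>" "\<And>n. fst (x n) \<in> kernel\<^sup>\<bottom>" "\<And>n. norm (fst (x n)) = 1"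
    "\<And>n. norm (snd (x n)) \<le> 1 / Suc n" by metis
  have bdd: "norm (x n) \<le> 2" for n
  proof -
    have "norm (snd (x n)) \<le> 1" using x(4)[of n] by (rule order_trans) simp
    then show ?thesis using norm_triangle_ineq[of "(fst (x n), 0)" "(0, snd (x n))"] x(3)[of n]
      by (simp add: norm_Pair)
  qed
  obtain s l where s: "strict_mono s" "(\<lambda>n. fst (x (s n))) \<longlonglongrightarrow> l"
    by (rule compact_image_subsequence[OF bounded_linear_fst subspace_graph compact_fst x(1) bdd])
  have "(\<lambda>n. snd (x n)) \<longlonglongrightarrow> 0"
    by (rule Lim_null_comparison[OF _ LIMSEQ_Suc[OF lim_const_over_n[of 1]]]) (use x(4) in simp)
  then have "(\<lambda>n. snd (x (s n))) \<longlonglongrightarrow> 0"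
    using LIMSEQ_subseq_LIMSEQ[OF _ s(1)] by (force simp: o_def)
  then have "(\<lambda>n. (fst (x (s n)), snd (x (s n)))) \<longlonglongrightarrow> (l, 0)" by (intro tendsto_Pair s(2))
  from closed_sequentially[OF closed_graph _ this] have "(l, 0) \<in> \<Gamma>" using x(1) by simp
  then have "inner (fst (x n)) l = 0" for n
    using x(2)[of n] by (auto simp: kernel_def orthogonal_comp_def orthogonal_def inner_commute)
  moreover have "(\<lambda>n. inner (fst (x (s n))) l) \<longlonglongrightarrow> inner l l" by (intro tendsto_intros s(2))
  ultimately have "inner l l = 0" using LIMSEQ_unique by fastforce
  moreover have "norm l = 1"
    using tendsto_norm[OF s(2)] x(3) by (simp add: LIMSEQ_const_iff)
  ultimately show False by simp
qed

text \<open>Subtracting the kernel component leaves the second entry unchanged, so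
  \<open>poincare\<close> applies to some preimage of every element of the range.\<close>

lemma kernel_comp_preimage:
  assumes "r \<in> snd ` \<Gamma>" obtains v where "(v, r) \<in> \<Gamma>" "v \<in> kernel\<^sup>\<bottom>"
proof -
  obtain u where u: "(u, r) \<in> \<Gamma>" using assms by force
  have "(oproj kernel u, 0) \<in> \<Gamma>"
    using oproj_in[OF subspace_kernel closed_kernel, of u] by (simp add: kernel_def)
  then have "(u - oproj kernel u, r) \<in> \<Gamma>" using subspace_diff[OF subspace_graph u] by force
  then show ?thesis using that diff_oproj_in_comp[OF subspace_kernel closed_kernel] by blast
qed

lemma subspace_range: "subspace (snd ` \<Gamma>)"
  by (rule linear_subspace_image[OF bounded_linear.linear[OF bounded_linear_snd] subspace_graph])

text \<open>By \<open>poincare\<close>, preimages chosen orthogonal to the kernel inherit the Cauchy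
  property from their images; the closed graph contains the limit pair.\<close>

lemma closed_range: "closed (snd ` \<Gamma>)"
  unfolding closed_sequential_limits
proof (intro allI impI, elim conjE)
  fix r l assume r: "\<forall>n. r n \<in> snd ` \<Gamma>" "r \<longlonglongrightarrow> l"
  obtain C where C: "C \<ge> 0" "\<And>v r. (v, r) \<in> \<Gamma> \<Longrightarrow> v \<in> kernel\<^sup>\<bottom> \<Longrightarrow> norm v \<le> C * norm r"
    using poincare by blast
  have "\<exists>v. (v, r n) \<in> \<Gamma> \<and> v \<in> kernel\<^sup>\<bottom>" for n using r(1) kernel_comp_preimage by metis
  then obtain v where v: "\<And>n. (v n, r n) \<in> \<Gamma>" "\<And>n. v n \<in> kernel\<^sup>\<bottom>" by metis
  have le: "dist (v i) (v j) \<le> C * dist (r i) (r j)" for i j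
    using C(2)[of "v i - v j" "r i - r j"] subspace_diff[OF subspace_graph v(1) v(1), of i j]
      subspace_diff[OF subspace_orthogonal_comp v(2) v(2), of i j] by (simp add: dist_norm)
  have "Cauchy v"
    unfolding Cauchy_def
  proof (intro allI impI)
    fix e :: real assume e: "e > 0"
    \<comment> \<open>The constant is enlarged to C + 1 because C may vanish.\<close>
    then obtain M where M: "\<And>m n. m \<ge> M \<Longrightarrow> n \<ge> M \<Longrightarrow> dist (r m) (r n) < e / (C + 1)"
      using LIMSEQ_imp_Cauchy[OF r(2)] C(1) unfolding Cauchy_def
      by (metis add_nonneg_pos divide_pos_pos zero_less_one)
    have "dist (v m) (v n) < e" if "m \<ge> M" "n \<ge> M" for m n
    proof -
      have "dist (v m) (v n) \<le> (C + 1) * dist (r m) (r n)"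
        using le[of m n] by (simp add: distrib_right add_increasing2)
      also have "\<dots> < e" using M[OF that] C(1) by (simp add: field_simps)
      finally show ?thesis .
    qed
    then show "\<exists>M. \<forall>m\<ge>M. \<forall>n\<ge>M. dist (v m) (v n) < e" by blast
  qed
  then obtain u where "v \<longlonglongrightarrow> u" using Cauchy_convergent convergent_def by blast
  then have "(\<lambda>n. (v n, r n)) \<longlonglongrightarrow> (u, l)" by (intro tendsto_Pair r(2))
  from closed_sequentially[OF closed_graph v(1) this] have "(u, l) \<in> \<Gamma>" .
  then show "l \<in> snd ` \<Gamma>" by force
qed

abbreviation "range_graph \<equiv> snd ` \<Gamma>"

section \<open>Passing to the limit in the coefficients\<close>

context
  fixes mn :: "nat \<Rightarrow> 'a \<Rightarrow> 'a" and m :: "'a \<Rightarrow> 'a" and an :: "nat \<Rightarrow> 'b \<Rightarrow> 'b" and a :: "'b \<Rightarrow> 'b"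
    and \<mu> M :: real
  assumes mn: "\<And>n. coercive \<mu> (mn n)" and m: "coercive \<mu> m"
    and an: "\<And>n. coercive \<mu> (an n)" and a: "coercive \<mu> a"
    and an_bound: "\<And>n y. norm (an n y) \<le> M * norm y"
    and m_weak: "\<And>x y. (\<lambda>n. inner (mn n x) y) \<longlonglongrightarrow> inner (m x) y"
    and a_weak: "\<And>p y. p \<in> range_graph \<Longrightarrow> y \<in> range_graph \<Longrightarrow>
      (\<lambda>n. inner (galerkin range_graph (an n) p) y) \<longlonglongrightarrow> inner (galerkin range_graph a p) y"
begin

text \<open>Banach-Steinhaus at two levels: weak convergence bounds each orbit
  \<open>mn n x\<close>, and bounded orbits bound the operators uniformly.\<close>

lemma coefficients_uniformly_bounded: "\<exists>C\<ge>0. \<forall>n x. norm (mn n x) \<le> C * norm x"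
proof -
  obtain C where C: "\<And>n x. norm (mn n x) \<le> C * norm x"
  proof (rule uniform_boundedness[of mn])
    show "bounded_linear (mn n)" for n using mn by (simp add: coercive_def)
    show "\<exists>C. \<forall>n. norm (mn n x) \<le> C" for x
    proof (rule weakly_convergent_bounded[of "\<lambda>n. mn n x"])
      show "convergent (\<lambda>n. inner (mn n x) h)" for h using m_weak convergentI by blast
    qed blast
  qed blast
  have "norm (mn n x) \<le> \<bar>C\<bar> * norm x" for n x
    using C[of n x] mult_right_mono[OF abs_ge_self[of C] norm_ge_zero[of x]] by linarith
  then show ?thesis by (intro exI[of _ "\<bar>C\<bar>"]) simp
qed

text \<open>Along a subsequence \<open>fst x\<^sub>n\<close> converges strongly by compactness. The equation then expresses the
  fluxes \<open>q\<^sub>n\<close>, the projections of \<open>a\<^sub>n (snd x\<^sub>n)\<close>, through quantities that are paired with a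
  compactly embedded space, so \<open>q\<^sub>n\<close> converges strongly as well, and \<open>snd x\<^sub>n\<close> is the image of
  \<open>q\<^sub>n\<close> under the weakly convergent compressed inverses.\<close>

lemma galerkin_weak_subsequence:
  assumes r: "strict_mono r" and y: "y \<longlonglongrightarrow> l"
  shows "\<exists>s. strict_mono s \<and> (\<forall>h. (\<lambda>n. inner (galerkin \<Gamma> (map_prod (mn (r (s n))) (an (r (s n)))) (y (s n))) h)
           \<longlonglongrightarrow> inner (galerkin \<Gamma> (map_prod m a) l) h)"
proof -
  let ?R = range_graph
  note co = coercive_map_prod[OF mn an] and co' = coercive_map_prod[OF m a]
  note sub = subspace_graph closed_graph and subR = subspace_range closed_range
  have \<mu>: "\<mu> > 0" using m by (simp add: coercive_def)
  define x where "x n = galerkin \<Gamma> (map_prod (mn (r n)) (an (r n))) (y n)" for n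
  have x\<Gamma>: "x n \<in> \<Gamma>" for n unfolding x_def by (rule galerkin_in[OF sub co])
  obtain Y where Y: "\<And>n. norm (y n) \<le> Y"
    using convergent_imp_Bseq[OF convergentI[OF y]] by (auto simp: Bseq_def)
  define B where "B = Y / \<mu>"
  have xB: "norm (x n) \<le> B" for n
    unfolding x_def B_def
    by (rule order_trans[OF norm_galerkin_le[OF sub co]]) (use \<mu> Y in \<open>simp add: divide_right_mono\<close>)
  have xfB: "norm (fst (x n)) \<le> B" and xsB: "norm (snd (x n)) \<le> B" for n
    using xB[of n] norm_fst_le[of "fst (x n)" "snd (x n)"] norm_snd_le[of "snd (x n)" "fst (x n)"]
    by (auto intro: order_trans)
  have B: "B \<ge> 0" using xB[of 0] norm_ge_zero order_trans by blast
  obtain s u where s: "strict_mono s" and u: "(\<lambda>n. fst (x (s n))) \<longlonglongrightarrow> u"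
    by (rule compact_image_subsequence[OF bounded_linear_fst subspace_graph compact_fst x\<Gamma> xB])
  \<comment> \<open>The solutions and the data are already indexed along \<open>r\<close> and take
    \<open>s n\<close>; the coefficients take the composed index.\<close>
  define k where "k n = r (s n)" for n
  have k: "strict_mono k" using r s by (simp add: k_def strict_mono_def)
  have ys: "(\<lambda>n. y (s n)) \<longlonglongrightarrow> l" using LIMSEQ_subseq_LIMSEQ[OF y s] by (simp add: o_def)
  obtain C where C: "C \<ge> 0" "\<And>n x. norm (mn n x) \<le> C * norm x"
    using coefficients_uniformly_bounded by blast
  define z where "z n = mn (k n) (fst (x (s n)))" for n
  have zB: "norm (z n) \<le> C * B" for n
    unfolding z_def by (rule order_trans[OF C(2) mult_left_mono[OF xfB C(1)]])
  have z: "(\<lambda>n. inner (z n) h) \<longlonglongrightarrow> inner (m u) h" for h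
  proof -
    \<comment> \<open>The uniform bound C absorbs the strong error in the argument; what remains is
      \<open>mn (k n)\<close> at the fixed vector u.\<close>
    have "(\<lambda>n. inner (mn (k n) (fst (x (s n)) - u)) h) \<longlonglongrightarrow> 0"
    proof (rule Lim_null_comparison)
      have "norm (inner (mn (k n) v) h) \<le> C * norm v * norm h" for n v
        using Cauchy_Schwarz_ineq2[of "mn (k n) v" h]
          mult_right_mono[OF C(2)[of "k n" v], of "norm h"] by simp
      then show "\<forall>\<^sub>F n in sequentially. norm (inner (mn (k n) (fst (x (s n)) - u)) h)
          \<le> C * norm (fst (x (s n)) - u) * norm h" by simp
      show "(\<lambda>n. C * norm (fst (x (s n)) - u) * norm h) \<longlonglongrightarrow> 0"
        using u by (intro tendsto_mult_left_zero tendsto_mult_right_zero tendsto_norm_zero LIM_zero)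
    qed
    moreover have "(\<lambda>n. inner (mn (k n) u) h) \<longlonglongrightarrow> inner (m u) h"
      using LIMSEQ_subseq_LIMSEQ[OF m_weak k] by (simp add: o_def)
    ultimately have "(\<lambda>n. inner (mn (k n) (fst (x (s n)) - u)) h + inner (mn (k n) u) h) \<longlonglongrightarrow> 0 + inner (m u) h"
      by (rule tendsto_add)
    moreover have "mn (k n) (fst (x (s n)) - u) = z n - mn (k n) u" for n
      using mn[of "k n"] by (simp add: z_def coercive_def bounded_linear.linear linear_diff)
    ultimately show ?thesis by (simp add: inner_diff_left)
  qed
  define q where "q n = oproj ?R (an (k n) (snd (x (s n))))" for n
  have qR: "q n \<in> ?R" for n unfolding q_def by (rule oproj_in[OF subR])
  have qB: "norm (q n) \<le> \<bar>M\<bar> * B" for n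
  proof -
    have "norm (q n) \<le> M * norm (snd (x (s n)))"
      unfolding q_def by (rule order_trans[OF norm_oproj_le[OF subR] an_bound])
    also have "\<dots> \<le> \<bar>M\<bar> * norm (snd (x (s n)))" by (simp add: mult_right_mono)
    also have "\<dots> \<le> \<bar>M\<bar> * B"
      by (intro mult_left_mono xsB) simp
    finally show ?thesis .
  qed
  \<comment> \<open>The variational equation solved for the flux. Testing with g in the range sees
    only the projection of a_n (snd x_n), and the right-hand side contains no gradient of the
    solution.\<close>
  have eq: "inner (q n) g = inner (y (s n)) (v, g) - inner (z n) v" if vg: "(v, g) \<in> \<Gamma>" for n v g
  proof -
    have g: "g \<in> ?R" using vg by force
    have "inner (map_prod (mn (k n)) (an (k n)) (x (s n))) (v, g) = inner (y (s n)) (v, g)"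
      unfolding x_def k_def by (rule galerkin_inner[OF sub co vg])
    then show ?thesis
      by (cases "x (s n)") (simp add: z_def q_def oproj_inner[OF subR g])
  qed
  have q_lim: "(\<lambda>n. inner (q n) g) \<longlonglongrightarrow> inner l (v, g) - inner (m u) v" if "(v, g) \<in> \<Gamma>" for v g
    unfolding eq[OF that] by (intro tendsto_intros ys z)
  obtain p where p: "p \<in> ?R" "\<And>g. g \<in> ?R \<Longrightarrow> (\<lambda>n. inner (q n) g) \<longlonglongrightarrow> inner p g"
  proof (rule weak_limit_exists[OF subR _ qB])
    show "convergent (\<lambda>n. inner (q n) g)" if "g \<in> ?R" for g
      using that q_lim convergentI by fastforce
  qed blast
  have p_eq: "inner p g = inner l (v, g) - inner (m u) v" if vg: "(v, g) \<in> \<Gamma>" for v g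
    using p(2)[of g] q_lim[OF vg] vg by (force intro: LIMSEQ_unique)
  have q: "q \<longlonglongrightarrow> p"
  proof (rule tendsto_if_subsequences)
    fix t :: "nat \<Rightarrow> nat" assume t: "strict_mono t"
    obtain K where K: "K \<ge> 0" "\<And>v g. (v, g) \<in> \<Gamma> \<Longrightarrow> v \<in> kernel\<^sup>\<bottom> \<Longrightarrow> norm v \<le> K * norm g"
      using poincare by blast
    define d where "d n = q (t n) - p" for n
    have dR: "d n \<in> ?R" for n unfolding d_def by (rule subspace_diff[OF subR(1) qR p(1)])
    define E where "E = \<bar>M\<bar> * B + norm p"
    have dE: "norm (d n) \<le> E" for n
      unfolding d_def E_def using norm_triangle_ineq4[of "q (t n)" p] qB[of "t n"] by linarith
    \<comment> \<open>The error d is lifted to the graph in order to serve as its own test function.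
      Choosing the lift orthogonal to the kernel bounds v by \<open>poincare\<close>, so that v
      converges strongly along a further subsequence.\<close>
    have "\<exists>v. (v, d n) \<in> \<Gamma> \<and> v \<in> kernel\<^sup>\<bottom>" for n using dR kernel_comp_preimage by metis
    then obtain v where v: "\<And>n. (v n, d n) \<in> \<Gamma>" "\<And>n. v n \<in> kernel\<^sup>\<bottom>" by metis
    have vB: "norm (v n, d n) \<le> K * E + E" for n
      using K(2)[OF v(1) v(2), of n] mult_left_mono[OF dE K(1), of n] dE[of n]
        norm_Pair_le[of "v n" "d n"] by linarith
    obtain t' w where t': "strict_mono t'" and w: "(\<lambda>n. fst (v (t' n), d (t' n))) \<longlonglongrightarrow> w"
      by (rule compact_image_subsequence[OF bounded_linear_fst subspace_graph compact_fst v(1) vB])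
    let ?i = "\<lambda>n. t (t' n)"
    have i: "strict_mono ?i" using t t' by (simp add: strict_mono_def)
    \<comment> \<open>Since the test pair varies with n, weak convergence of q would not suffice.
      The formulas \<open>eq\<close> and \<open>p_eq\<close> leave a strongly null sequence against
      a bounded one, and a weakly null sequence against the strongly convergent v.\<close>
    have "(norm (d (t' n)))\<^sup>2 = inner (y (s (?i n)) - l) (v (t' n), d (t' n)) - inner (z (?i n) - m u) (v (t' n))" for n
    proof -
      have "(norm (d (t' n)))\<^sup>2 = inner (q (?i n)) (d (t' n)) - inner p (d (t' n))"
        unfolding power2_norm_eq_inner by (simp add: d_def inner_diff_left)
      then show ?thesis by (simp only: eq[OF v(1)] p_eq[OF v(1)]) (simp only: inner_diff_left)
    qed
    moreover have "(\<lambda>n. inner (y (s (?i n)) - l) (v (t' n), d (t' n))) \<longlonglongrightarrow> 0"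
    proof (rule Lim_null_comparison)
      have "norm (inner (y (s (?i n)) - l) (v (t' n), d (t' n))) \<le> norm (y (s (?i n)) - l) * (K * E + E)" for n
        using Cauchy_Schwarz_ineq2[of "y (s (?i n)) - l" "(v (t' n), d (t' n))"]
          mult_left_mono[OF vB[of "t' n"], of "norm (y (s (?i n)) - l)"] by (simp only: real_norm_def) simp
      then show "\<forall>\<^sub>F n in sequentially. norm (inner (y (s (?i n)) - l) (v (t' n), d (t' n)))
          \<le> norm (y (s (?i n)) - l) * (K * E + E)" by (intro always_eventually allI)
      show "(\<lambda>n. norm (y (s (?i n)) - l) * (K * E + E)) \<longlonglongrightarrow> 0"
        using LIMSEQ_subseq_LIMSEQ[OF ys i]
        by (intro tendsto_mult_left_zero tendsto_norm_zero LIM_zero) (simp add: o_def)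
    qed
    moreover have "(\<lambda>n. inner (z (?i n) - m u) (v (t' n))) \<longlonglongrightarrow> inner 0 w"
    proof (rule tendsto_inner_weak_strong)
      show "(\<lambda>n. inner (z (?i n) - m u) h) \<longlonglongrightarrow> inner 0 h" for h
        using tendsto_diff[OF LIMSEQ_subseq_LIMSEQ[OF z[of h] i] tendsto_const[of "inner (m u) h"]]
        by (simp add: o_def inner_diff_left)
      show "norm (z (?i n) - m u) \<le> C * B + norm (m u)" for n
        using norm_triangle_ineq4[of "z (?i n)" "m u"] zB[of "?i n"] by linarith
      show "(\<lambda>n. v (t' n)) \<longlonglongrightarrow> w" using w by simp
    qed
    ultimately have "(\<lambda>n. (norm (d (t' n)))\<^sup>2) \<longlonglongrightarrow> 0 - inner 0 w" by (simp only: tendsto_diff)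
    then have "(\<lambda>n. norm (d (t' n))) \<longlonglongrightarrow> 0" by simp
    then have "(\<lambda>n. q (t (t' n))) \<longlonglongrightarrow> p"
      unfolding d_def by (rule LIM_zero_cancel[OF tendsto_norm_zero_cancel])
    then show "\<exists>t'. strict_mono t' \<and> (\<lambda>n. q (t (t' n))) \<longlonglongrightarrow> p" using t' by blast
  qed
  define g where "g = galerkin ?R a p"
  have xq: "snd (x (s n)) = galerkin ?R (an (k n)) (q n)" for n
    by (rule galerkin_eqI[OF subR an, symmetric])
      (use x\<Gamma> in \<open>auto simp: q_def oproj_inner[OF subR]\<close>)
  have g_R: "(\<lambda>n. inner (snd (x (s n))) h) \<longlonglongrightarrow> inner g h" if h: "h \<in> ?R" for h
  proof -
    \<comment> \<open>The compressed inverses share the bound 1 / \<mu>, so q n may be replaced by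
      its strong limit p before \<open>a_weak\<close> is applied.\<close>
    have "(\<lambda>n. inner (galerkin ?R (an (k n)) (q n - p)) h) \<longlonglongrightarrow> 0"
    proof (rule Lim_null_comparison)
      have "norm (inner (galerkin ?R (an (k n)) (q n - p)) h) \<le> norm (q n - p) / \<mu> * norm h" for n
        using Cauchy_Schwarz_ineq2[of "galerkin ?R (an (k n)) (q n - p)" h]
          mult_right_mono[OF norm_galerkin_le[OF subR an[of "k n"], of "q n - p"] norm_ge_zero[of h]]
        by simp
      then show "\<forall>\<^sub>F n in sequentially. norm (inner (galerkin ?R (an (k n)) (q n - p)) h)
          \<le> norm (q n - p) / \<mu> * norm h" by simp
      show "(\<lambda>n. norm (q n - p) / \<mu> * norm h) \<longlonglongrightarrow> 0"
        using q by (intro tendsto_mult_left_zero tendsto_divide_zero tendsto_norm_zero LIM_zero)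
    qed
    moreover have "(\<lambda>n. inner (galerkin ?R (an (k n)) p) h) \<longlonglongrightarrow> inner g h"
      unfolding g_def using LIMSEQ_subseq_LIMSEQ[OF a_weak[OF p(1) h] k] by (simp add: o_def)
    ultimately have "(\<lambda>n. inner (galerkin ?R (an (k n)) (q n - p)) h
        + inner (galerkin ?R (an (k n)) p) h) \<longlonglongrightarrow> 0 + inner g h" by (rule tendsto_add)
    moreover have "galerkin ?R (an (k n)) (q n - p) = snd (x (s n)) - galerkin ?R (an (k n)) p" for n
      using bounded_linear_galerkin[OF subR an]
      by (simp add: xq bounded_linear.linear linear_diff)
    ultimately show ?thesis by (simp add: inner_diff_left)
  qed
  have gR: "g \<in> ?R" unfolding g_def by (rule galerkin_in[OF subR a])
  have g: "(\<lambda>n. inner (snd (x (s n))) h) \<longlonglongrightarrow> inner g h" for h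
  proof -
    \<comment> \<open>All gradients and g lie in the range, so an arbitrary test vector may be
      projected there.\<close>
    have "inner v h = inner v (oproj ?R h)" if "v \<in> ?R" for v
      using oproj_inner[OF subR that, of h] by (simp add: inner_commute)
    then show ?thesis
      using g_R[OF oproj_in[OF subR, of h]] gR x\<Gamma> by simp
  qed
  have weak: "(\<lambda>n. inner (x (s n)) h) \<longlonglongrightarrow> inner (u, g) h" for h
    using tendsto_add[OF tendsto_inner[OF u tendsto_const[of "fst h"]] g[of "snd h"]]
    by (simp add: inner_prod_def)
  have ug: "(u, g) \<in> \<Gamma>" by (rule weak_limit_in_closed_subspace[OF sub x\<Gamma> weak])
  have "galerkin \<Gamma> (map_prod m a) l = (u, g)"
  proof (rule galerkin_eqI[OF sub co' ug])
    fix v assume v: "v \<in> \<Gamma>"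
    then have "inner (a g) (snd v) = inner p (snd v)"
      unfolding g_def by (intro galerkin_inner[OF subR a]) simp
    also have "\<dots> = inner l v - inner (m u) (fst v)" using p_eq[of "fst v" "snd v"] v by simp
    finally show "inner (map_prod m a (u, g)) v = inner l v" by (cases v) simp
  qed
  then show ?thesis using weak s unfolding x_def by auto
qed

text \<open>The limit is the same for every subsequence, so the whole sequence converges.\<close>

lemma galerkin_weak_convergence:
  "(\<lambda>n. inner (galerkin \<Gamma> (map_prod (mn n) (an n)) y) h) \<longlonglongrightarrow> inner (galerkin \<Gamma> (map_prod m a) y) h"
proof (rule tendsto_if_subsequences)
  fix r :: "nat \<Rightarrow> nat" assume "strict_mono r"
  from galerkin_weak_subsequence[OF this tendsto_const[of y]]
  show "\<exists>s. strict_mono s \<and> (\<lambda>n. inner (galerkin \<Gamma> (map_prod (mn (r (s n))) (an (r (s n)))) y) h)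
      \<longlonglongrightarrow> inner (galerkin \<Gamma> (map_prod m a) y) h" by blast
qed

text \<open>The operator norm is controlled by nearly maximising vectors, so it suffices that
  \<open>L n (\<psi> n)\<close> tends to zero for every sequence in the unit ball.\<close>

lemma galerkin_norm_convergence:
  fixes K :: "'a \<times> 'b \<Rightarrow> 'c::{real_inner,complete_space}" and K' :: "'c \<Rightarrow> 'a \<times> 'b"
  assumes K: "bounded_linear K" and K': "bounded_linear K'"
    and adj: "\<And>x \<psi>. inner (K x) \<psi> = inner x (K' \<psi>)"
    and c: "compact (closure (K ` cball 0 1))"
  shows "(\<lambda>n. onorm (\<lambda>\<psi>. K (galerkin \<Gamma> (map_prod (mn n) (an n)) (K' \<psi>))
      - K (galerkin \<Gamma> (map_prod m a) (K' \<psi>)))) \<longlonglongrightarrow> 0"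
proof -
  note sub = subspace_graph closed_graph
  note co = coercive_map_prod[OF mn an] and co' = coercive_map_prod[OF m a]
  have c': "compact (closure (K ` (UNIV \<inter> cball 0 1)))" using c by simp
  interpret K: bounded_linear K by (rule K)
  interpret K': bounded_linear K' by (rule K')
  define L where "L n = (\<lambda>\<psi>. K (galerkin \<Gamma> (map_prod (mn n) (an n)) (K' \<psi>))
      - K (galerkin \<Gamma> (map_prod m a) (K' \<psi>)))" for n
  have L: "bounded_linear (L n)" for n
    unfolding L_def
    by (intro bounded_linear_sub bounded_linear_compose[OF K] bounded_linear_compose[OF _ K']
        bounded_linear_galerkin[OF sub co] bounded_linear_galerkin[OF sub co'])
  have lim: "(\<lambda>n. L n (\<psi> n)) \<longlonglongrightarrow> 0" if \<psi>: "\<And>n. norm (\<psi> n) \<le> 1" for \<psi>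
  proof (rule tendsto_if_subsequences)
    fix r :: "nat \<Rightarrow> nat" assume r: "strict_mono r"
    obtain B where B: "\<And>x. norm (K' x) \<le> norm x * B" "B \<ge> 0" using K'.nonneg_bounded by blast
    have K'B: "norm (K' (\<psi> (r n))) \<le> B" for n
      using B(1)[of "\<psi> (r n)"] mult_right_mono[OF \<psi>[of "r n"] B(2)] by simp
    obtain s l where s: "strict_mono s" and l: "(\<lambda>n. K (K' (\<psi> (r (s n))))) \<longlonglongrightarrow> l"
      by (rule compact_image_subsequence[OF K subspace_UNIV c' UNIV_I K'B])
    define f where "f n = K' (\<psi> (r (s n)))" for n
    \<comment> \<open>Compactness passes from \<open>K\<close> to its adjoint through |K' e|^2 = (K
      K' e, e): convergence of the vectors K (f n) makes f itself Cauchy.\<close>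
    have "Cauchy f"
    proof (rule Cauchy_if_dist_power2_le)
      show "(\<lambda>n. 2 * norm (K (f n) - l)) \<longlonglongrightarrow> 0"
        unfolding f_def using l by (intro tendsto_mult_right_zero tendsto_norm_zero LIM_zero)
      fix i j
      define e where "e = \<psi> (r (s i)) - \<psi> (r (s j))"
      have fe: "f i - f j = K' e" by (simp add: f_def e_def K'.diff)
      have e2: "norm e \<le> 2"
        unfolding e_def using norm_triangle_ineq4[of "\<psi> (r (s i))" "\<psi> (r (s j))"]
          \<psi>[of "r (s i)"] \<psi>[of "r (s j)"] by linarith
      have "(dist (f i) (f j))\<^sup>2 = inner (K (f i - f j)) e"
        unfolding dist_norm power2_norm_eq_inner adj fe ..
      also have "\<dots> \<le> norm (K (f i - f j)) * norm e" by (rule norm_cauchy_schwarz)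
      also have "\<dots> \<le> norm (K (f i - f j)) * 2" using e2 by (intro mult_left_mono) auto
      also have "norm (K (f i - f j)) \<le> norm (K (f i) - l) + norm (K (f j) - l)"
        using norm_triangle_ineq4[of "K (f i) - l" "K (f j) - l"] by (simp add: K.diff)
      finally show "(dist (f i) (f j))\<^sup>2 \<le> 2 * norm (K (f i) - l) + 2 * norm (K (f j) - l)" by simp
    qed
    then obtain y where y: "f \<longlonglongrightarrow> y" using Cauchy_convergent convergent_def by blast
    have rs: "strict_mono (\<lambda>n. r (s n))" using r s by (simp add: strict_mono_def)
    define x where "x n = galerkin \<Gamma> (map_prod (mn (r (s n))) (an (r (s n)))) (f n)" for n
    define x\<^sub>0 where "x\<^sub>0 = galerkin \<Gamma> (map_prod m a) y"
    obtain t where t: "strict_mono t"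
      and weak: "\<And>h. (\<lambda>n. inner (x (t n)) h) \<longlonglongrightarrow> inner x\<^sub>0 h"
      using galerkin_weak_subsequence[OF rs y] unfolding x_def x\<^sub>0_def by blast
    have xB: "norm (x (t n)) \<le> B / \<mu>" for n
      unfolding x_def
      by (rule order_trans[OF norm_galerkin_le[OF sub co]])
        (use m K'B in \<open>simp add: f_def coercive_def divide_right_mono\<close>)
    obtain t' k where t': "strict_mono t'" and k: "(\<lambda>n. K (x (t (t' n)))) \<longlonglongrightarrow> k"
      by (rule compact_image_subsequence[OF K subspace_UNIV c' UNIV_I xB])
    \<comment> \<open>Compactness of \<open>K\<close> supplies a strong limit k; moving
      \<open>K\<close> to the test vector identifies it through the weak limit of x.\<close>
    have "inner k h = inner (K x\<^sub>0) h" for h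
    proof (rule LIMSEQ_unique)
      show "(\<lambda>n. inner (K (x (t (t' n)))) h) \<longlonglongrightarrow> inner k h" by (intro tendsto_intros k)
      show "(\<lambda>n. inner (K (x (t (t' n)))) h) \<longlonglongrightarrow> inner (K x\<^sub>0) h"
        unfolding adj using LIMSEQ_subseq_LIMSEQ[OF weak t'] by (simp add: o_def)
    qed
    then have "k = K x\<^sub>0" using vector_eq_rdot by blast
    have "(\<lambda>n. f (t (t' n))) \<longlonglongrightarrow> y"
      using LIMSEQ_subseq_LIMSEQ[OF LIMSEQ_subseq_LIMSEQ[OF y t] t'] by (simp add: o_def)
    then have "(\<lambda>n. K (galerkin \<Gamma> (map_prod m a) (f (t (t' n))))) \<longlonglongrightarrow> K x\<^sub>0"
      unfolding x\<^sub>0_def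
      by (intro K.tendsto bounded_linear.tendsto[OF bounded_linear_galerkin[OF sub co']])
    from tendsto_diff[OF k this] have "(\<lambda>n. L (r (s (t (t' n)))) (\<psi> (r (s (t (t' n)))))) \<longlonglongrightarrow> 0"
      by (simp add: L_def x_def f_def \<open>k = K x\<^sub>0\<close>)
    moreover have "strict_mono (\<lambda>n. s (t (t' n)))" using s t t' by (simp add: strict_mono_def)
    ultimately show "\<exists>s. strict_mono s \<and> (\<lambda>n. L (r (s n)) (\<psi> (r (s n)))) \<longlonglongrightarrow> 0" by blast
  qed
  \<comment> \<open>The norm need not be attained; the factor 2 leaves room for a nearly maximising
    vector.\<close>
  have "\<exists>\<psi>. norm \<psi> \<le> 1 \<and> onorm (L n) \<le> 2 * norm (L n \<psi>)" for n
  proof (rule ccontr)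
    assume no: "\<nexists>\<psi>. norm \<psi> \<le> 1 \<and> onorm (L n) \<le> 2 * norm (L n \<psi>)"
    then have pos: "onorm (L n) > 0" by (metis bounded_linear.linear[OF L] linear_0 mult_zero_right norm_zero not_le zero_le_one)
    have "norm (L n x) \<le> onorm (L n) / 2 * norm x" for x
    proof (cases "x = 0")
      case False
      then have "norm (x /\<^sub>R norm x) \<le> 1" by simp
      then have "2 * norm (L n (x /\<^sub>R norm x)) < onorm (L n)" using no not_le by blast
      then show ?thesis
        using False by (simp add: linear_cmul[OF bounded_linear.linear[OF L]] field_simps)
    qed (simp add: linear_0[OF bounded_linear.linear[OF L]])
    then have "onorm (L n) \<le> onorm (L n) / 2" using pos by (intro onorm_bound) auto
    then show False using pos by simp
  qed
  then obtain \<psi> where \<psi>: "\<And>n. norm (\<psi> n) \<le> 1" "\<And>n. onorm (L n) \<le> 2 * norm (L n (\<psi> n))"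
    by metis
  show ?thesis
    unfolding L_def[symmetric]
  proof (rule Lim_null_comparison)
    show "\<forall>\<^sub>F n in sequentially. norm (onorm (L n)) \<le> 2 * norm (L n (\<psi> n))"
      using \<psi>(2) onorm_pos_le[OF L] by simp
    show "(\<lambda>n. 2 * norm (L n (\<psi> n))) \<longlonglongrightarrow> 0"
      by (intro tendsto_mult_right_zero tendsto_norm_zero lim \<psi>(1))
  qed
qed

end

end

section \<open>Reduction to real inner products\<close>

lemma cstruct_inner_right: "cstruct J \<Longrightarrow> inner x (J y) = - inner (J x) y"
  unfolding cstruct_def by (metis inner_minus_right minus_equation_iff)

lemma cinner_eq_0_iff:
  assumes "\<And>q. q \<in> S \<Longrightarrow> J q \<in> S"
  shows "(\<forall>q\<in>S. cinner J x q = 0) \<longleftrightarrow> (\<forall>q\<in>S. inner x q = 0)"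
  using assms by (auto simp: cinner_def complex_eq_iff)

text \<open>The imaginary part of the identity at x is, up to sign, the real identity at J
  x.\<close>

lemma cinner_transpose_iff:
  assumes J: "cstruct J" "cstruct J'" and T: "clinear_on J J' S T"
  shows "(\<forall>x\<in>S. cinner J' (T x) y = cinner J x z) \<longleftrightarrow> (\<forall>x\<in>S. inner (T x) y = inner x z)"
proof -
  have "inner (T x) (J' y) = inner x (J z)"
    if "\<forall>x\<in>S. inner (T x) y = inner x z" "x \<in> S" for x
  proof -
    have "J x \<in> S" "T (J x) = J' (T x)" using T that by (auto simp: clinear_on_def csubspace_def)
    then show ?thesis using that by (metis J cstruct_inner_right)
  qed
  then show ?thesis by (auto simp: cinner_def complex_eq_iff)
qed

lemma adj_dom_iff:
  assumes "cstruct J" "cstruct J'" "clinear_on J J' S T"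
  shows "y \<in> adj_dom J J' S T \<longleftrightarrow> (\<exists>z. \<forall>x\<in>S. inner (T x) y = inner x z)"
  by (simp add: adj_dom_def cinner_transpose_iff[OF assms])

lemma adj_eqI:
  assumes J: "cstruct J" "cstruct J'" "clinear_on J J' S T" and dense: "closure S = UNIV"
    and z: "\<And>x. x \<in> S \<Longrightarrow> inner (T x) y = inner x z"
  shows "adj J J' S T y = z"
  unfolding adj_def cinner_transpose_iff[OF J]
proof (rule the_equality)
  show "\<forall>x\<in>S. inner (T x) y = inner x z" using z by blast
next
  fix z' assume z': "\<forall>x\<in>S. inner (T x) y = inner x z'"
  have "closure S \<subseteq> {x. inner x (z' - z) = 0}"
    by (rule closure_minimal) (use z z' in \<open>auto simp: inner_diff_right
        intro!: closed_Collect_eq continuous_intros\<close>)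
  then have "inner (z' - z) (z' - z) = 0" using dense by blast
  then show "z' = z" by simp
qed

lemma clinear_on_diff:
  assumes "clinear_on J J' S T" "x \<in> S" "y \<in> S"
  shows "x - y \<in> S" "T (x - y) = T x - T y"
proof -
  have S: "subspace S" using assms by (simp add: clinear_on_def csubspace_def)
  show "x - y \<in> S" using S assms by (simp add: subspace_diff)
  have "T (x + (-1) *\<^sub>R y) = T x + (-1) *\<^sub>R T y"
    using assms S subspace_scale[OF S assms(3), of "-1"] unfolding clinear_on_def by metis
  then show "T (x - y) = T x - T y" by simp
qed

lemma subspace_graph_of:
  assumes T: "clinear_on J J' S T"
  shows "subspace ((\<lambda>u. (u, T u)) ` S)"
proof -
  have S: "subspace S" using T by (simp add: clinear_on_def csubspace_def)
  have "T 0 = 0" using clinear_on_diff(2)[OF T, of 0 0] subspace_0[OF S] by simp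
  then show ?thesis
    using T S unfolding subspace_def clinear_on_def
    by (auto simp: zero_prod_def image_iff)
qed

lemma orth_proj_eq_oproj: "(\<And>q. q \<in> R \<Longrightarrow> J q \<in> R) \<Longrightarrow> orth_proj J R y = oproj R y"
  by (simp add: orth_proj_def oproj_def cinner_eq_0_iff)

text \<open>Translates the compressed inverses of the hypothesis into the solution operator used in
  the convergence argument.\<close>

lemma compr_inv_eq_galerkin:
  fixes R :: "'b::{real_inner,complete_space} set"
  assumes R: "subspace R" "closed R" and J: "\<And>q. q \<in> R \<Longrightarrow> J q \<in> R" and w: "w \<in> R"
  shows "compr_inv J R a w = galerkin R a w"
proof -
  have "oproj R (a v) = w \<longleftrightarrow> (\<forall>q\<in>R. inner (a v) q = inner w q)" for v
    using oproj_eqI[OF R(1) w, of "a v"] oproj_inner[OF R, of _ "a v"] by (auto simp: inner_diff_left)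
  then show ?thesis
    by (simp add: compr_inv_def galerkin_def orth_proj_eq_oproj[OF J])
qed

section \<open>The Dirichlet-to-Neumann operator through orthogonal projections\<close>

text \<open>\<open>\<Gamma>\<close> is the graph of \<open>G\<close> and \<open>\<Delta>\<close> the flipped graph of \<open>D\<close>, both in \<open>H\<^sub>0 \<times> H\<^sub>1\<close> whose norm
  restricts to the graph norms. Then \<open>- G\<^sup>* \<subseteq> D\<close> says \<open>\<Gamma>\<^sup>\<bottom> \<subseteq> \<Delta>\<close>, the graph of \<open>- D\<^sup>*\<close> is \<open>\<Delta>\<^sup>\<bottom>\<close>, and
  \<open>\<Gamma> \<inter> \<Delta>\<close> is the graph of \<open>G\<close> on \<open>BD(G)\<close> as well as the flipped graph of \<open>D\<close> on \<open>BD(D)\<close>.\<close>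

locale operator_pair =
  fixes J0 :: "'a::{real_inner,complete_space} \<Rightarrow> 'a"
    and J1 :: "'b::{real_inner,complete_space} \<Rightarrow> 'b"
    and JH :: "'c::{real_inner,complete_space} \<Rightarrow> 'c"
    and dG :: "'a set" and G :: "'a \<Rightarrow> 'b"
    and dD :: "'b set" and D :: "'b \<Rightarrow> 'a"
    and \<kappa> :: "'a \<Rightarrow> 'c"
  assumes J0: "cstruct J0" and J1: "cstruct J1" and JH: "cstruct JH"
    and G: "dd_closed_op J0 J1 dG G" and D: "dd_closed_op J1 J0 dD D"
    and adj_dom_subset: "adj_dom J0 J1 dG G \<subseteq> dD"
    and adj_eq: "\<forall>y\<in>adj_dom J0 J1 dG G. D y = - adj J0 J1 dG G y"
    and \<kappa>_lin: "clinear_on J0 JH (BDG J0 J1 dG G dD D) \<kappa>"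
    and \<kappa>_bdd: "\<exists>C. \<forall>u\<in>BDG J0 J1 dG G dD D. norm (\<kappa> u) \<le> C * gnorm G u"
begin

definition "\<Gamma> = (\<lambda>u. (u, G u)) ` dG"
definition "\<Delta> = (\<lambda>w. (D w, w)) ` dD"

lemma G_lin: "clinear_on J0 J1 dG G" and D_lin: "clinear_on J1 J0 dD D"
  using G D by (auto simp: dd_closed_op_def)

lemma in_\<Gamma>_iff: "x \<in> \<Gamma> \<longleftrightarrow> fst x \<in> dG \<and> snd x = G (fst x)"
  by (cases x) (auto simp: \<Gamma>_def)

lemma in_\<Delta>_iff: "x \<in> \<Delta> \<longleftrightarrow> snd x \<in> dD \<and> fst x = D (snd x)"
  by (cases x) (auto simp: \<Delta>_def)

lemma subspace_\<Gamma>: "subspace \<Gamma>"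
  unfolding \<Gamma>_def by (rule subspace_graph_of[OF G_lin])

lemma closed_\<Gamma>: "closed \<Gamma>"
  using G by (simp add: dd_closed_op_def \<Gamma>_def)

lemma \<Delta>_eq: "\<Delta> = prod.swap -` (\<lambda>w. (w, D w)) ` dD"
  by (auto simp: \<Delta>_def)

lemma subspace_\<Delta>: "subspace \<Delta>"
  unfolding \<Delta>_eq
  by (rule linear_subspace_vimage[OF _ subspace_graph_of[OF D_lin]])
    (auto intro!: linearI simp: prod.swap_def)

lemma closed_\<Delta>: "closed \<Delta>"
  unfolding \<Delta>_eq using D by (intro closed_vimage continuous_on_swap) (simp add: dd_closed_op_def)

lemmas sub\<Gamma> = subspace_\<Gamma> closed_\<Gamma> and sub\<Delta> = subspace_\<Delta> closed_\<Delta>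

lemma J_\<Gamma>: "x \<in> \<Gamma> \<Longrightarrow> map_prod J0 J1 x \<in> \<Gamma>"
  using G_lin by (cases x) (auto simp: in_\<Gamma>_iff clinear_on_def csubspace_def)

lemma J_\<Delta>: "x \<in> \<Delta> \<Longrightarrow> map_prod J0 J1 x \<in> \<Delta>"
  using D_lin by (cases x) (auto simp: in_\<Delta>_iff clinear_on_def csubspace_def)

lemma cstruct_prod: "cstruct (map_prod J0 J1)"
  using J0 J1 unfolding cstruct_def linear_iff by auto

lemma J_comp:
  assumes "\<And>x. x \<in> S \<Longrightarrow> map_prod J0 J1 x \<in> S" "x \<in> S\<^sup>\<bottom>"
  shows "map_prod J0 J1 x \<in> S\<^sup>\<bottom>"
  using assms by (auto simp: orthogonal_comp_def orthogonal_def cstruct_inner_right[OF cstruct_prod])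

lemma ginner_G: "ginner J0 J1 G u v = cinner (map_prod J0 J1) (u, G u) (v, G v)"
  by (simp add: ginner_def cinner_def complex_eq_iff)

lemma ginner_D: "ginner J1 J0 D u v = cinner (map_prod J0 J1) (D u, u) (D v, v)"
  by (simp add: ginner_def cinner_def complex_eq_iff)

text \<open>Orthogonality of (z, w) to the graph of G reads (G u, w) = (u, -z), so -z is the adjoint
  value at w and z = D w.\<close>

lemma comp_\<Gamma>_eq: "\<Gamma>\<^sup>\<bottom> = (\<lambda>w. (D w, w)) ` adj_dom J0 J1 dG G"
proof (intro set_eqI iffI)
  fix x assume "x \<in> \<Gamma>\<^sup>\<bottom>"
  moreover obtain z w where x: "x = (z, w)" by (cases x)
  ultimately have eq: "inner (G u) w = inner u (- z)" if "u \<in> dG" for u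
    using that by (force simp: orthogonal_comp_def orthogonal_def \<Gamma>_def)
  then have w: "w \<in> adj_dom J0 J1 dG G" using adj_dom_iff[OF J0 J1 G_lin] by blast
  moreover have "adj J0 J1 dG G w = - z"
    by (rule adj_eqI[OF J0 J1 G_lin _ eq]) (use G in \<open>simp add: dd_closed_op_def\<close>)
  ultimately have "D w = z" using adj_eq by simp
  with w x show "x \<in> (\<lambda>w. (D w, w)) ` adj_dom J0 J1 dG G" by blast
next
  fix x assume "x \<in> (\<lambda>w. (D w, w)) ` adj_dom J0 J1 dG G"
  then obtain w where w: "w \<in> adj_dom J0 J1 dG G" and x: "x = (D w, w)" by blast
  obtain z where z: "\<And>u. u \<in> dG \<Longrightarrow> inner (G u) w = inner u z"
    using w adj_dom_iff[OF J0 J1 G_lin] by blast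
  have "adj J0 J1 dG G w = z"
    by (rule adj_eqI[OF J0 J1 G_lin _ z]) (use G in \<open>simp add: dd_closed_op_def\<close>)
  then have "D w = - z" using adj_eq w by simp
  then show "x \<in> \<Gamma>\<^sup>\<bottom>" using x z by (auto simp: orthogonal_comp_def orthogonal_def \<Gamma>_def)
qed

lemma comp_\<Gamma>_subset: "\<Gamma>\<^sup>\<bottom> \<subseteq> \<Delta>"
  using adj_dom_subset by (auto simp: comp_\<Gamma>_eq \<Delta>_def)

text \<open>In operator terms this is the inclusion of -D* in G, obtained by taking
  complements.\<close>

lemma comp_\<Delta>_subset: "\<Delta>\<^sup>\<bottom> \<subseteq> \<Gamma>"
  using orthogonal_comp_anti_mono[OF comp_\<Gamma>_subset] orthogonal_comp_comp[OF sub\<Gamma>] by simp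

lemma comp_\<Delta>_eq: "\<Delta>\<^sup>\<bottom> = (\<lambda>v. (v, G v)) ` adj_dom J1 J0 dD D"
proof (intro set_eqI iffI)
  fix x assume x: "x \<in> \<Delta>\<^sup>\<bottom>"
  then have "snd x = G (fst x)" using comp_\<Delta>_subset in_\<Gamma>_iff by blast
  moreover have "inner (D w) (fst x) = inner w (- snd x)" if "w \<in> dD" for w
    using x that by (cases x) (force simp: orthogonal_comp_def orthogonal_def \<Delta>_def)
  then have "fst x \<in> adj_dom J1 J0 dD D" using adj_dom_iff[OF J1 J0 D_lin] by blast
  ultimately show "x \<in> (\<lambda>v. (v, G v)) ` adj_dom J1 J0 dD D" by (cases x) auto
next
  fix x assume "x \<in> (\<lambda>v. (v, G v)) ` adj_dom J1 J0 dD D"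
  then obtain v where v: "v \<in> adj_dom J1 J0 dD D" and x: "x = (v, G v)" by blast
  obtain z where z: "\<And>w. w \<in> dD \<Longrightarrow> inner (D w) v = inner w z"
    using v adj_dom_iff[OF J1 J0 D_lin] by blast
  then have vz: "(v, - z) \<in> \<Delta>\<^sup>\<bottom>" by (auto simp: orthogonal_comp_def orthogonal_def \<Delta>_def)
  then have "(v, - z) \<in> \<Gamma>" using comp_\<Delta>_subset by blast
  then have "G v = - z" by (simp add: in_\<Gamma>_iff)
  with vz x show "x \<in> \<Delta>\<^sup>\<bottom>" by simp
qed

text \<open>BD(G) is cut out of \<Gamma> by the complement of \<Delta>, and \<Delta> is closed,
  hence its own double complement. Membership in \<Delta> records the identity D G u = u on
  BD(G).\<close>

lemma BDG_iff: "u \<in> BDG J0 J1 dG G dD D \<longleftrightarrow> (u, G u) \<in> \<Gamma> \<inter> \<Delta>"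
proof -
  have "(\<forall>v\<in>adj_dom J1 J0 dD D. ginner J0 J1 G u v = 0)
      \<longleftrightarrow> (\<forall>x\<in>\<Delta>\<^sup>\<bottom>. cinner (map_prod J0 J1) (u, G u) x = 0)"
    by (simp add: comp_\<Delta>_eq ginner_G)
  also have "\<dots> \<longleftrightarrow> (u, G u) \<in> \<Delta>\<^sup>\<bottom>\<^sup>\<bottom>"
    by (subst cinner_eq_0_iff) (auto intro: J_comp J_\<Delta> simp: in_orthogonal_comp_iff[of _ "\<Delta>\<^sup>\<bottom>"])
  finally show ?thesis by (simp add: BDG_def orthogonal_comp_comp[OF sub\<Delta>] in_\<Gamma>_iff)
qed

lemma BDD_iff: "w \<in> BDD J0 J1 dG G dD D \<longleftrightarrow> (D w, w) \<in> \<Gamma> \<inter> \<Delta>"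
proof -
  have "(\<forall>v\<in>adj_dom J0 J1 dG G. ginner J1 J0 D w v = 0)
      \<longleftrightarrow> (\<forall>x\<in>\<Gamma>\<^sup>\<bottom>. cinner (map_prod J0 J1) (D w, w) x = 0)"
    by (simp add: comp_\<Gamma>_eq ginner_D)
  also have "\<dots> \<longleftrightarrow> (D w, w) \<in> \<Gamma>\<^sup>\<bottom>\<^sup>\<bottom>"
    by (subst cinner_eq_0_iff) (auto intro: J_comp J_\<Gamma> simp: in_orthogonal_comp_iff[of _ "\<Gamma>\<^sup>\<bottom>"])
  finally show ?thesis by (auto simp: BDD_def orthogonal_comp_comp[OF sub\<Gamma>] in_\<Delta>_iff)
qed

lemma subW: "subspace (\<Gamma> \<inter> \<Delta>)" "closed (\<Gamma> \<inter> \<Delta>)"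
  using sub\<Gamma> sub\<Delta> by (auto simp: subspace_inter)

lemma in_W_G: "x \<in> \<Gamma> \<inter> \<Delta> \<Longrightarrow> fst x \<in> BDG J0 J1 dG G dD D \<and> x = (fst x, G (fst x))"
  by (cases x) (auto simp: BDG_iff in_\<Gamma>_iff)

lemma in_W_D: "x \<in> \<Gamma> \<inter> \<Delta> \<Longrightarrow> snd x \<in> BDD J0 J1 dG G dD D \<and> x = (D (snd x), snd x)"
  by (cases x) (auto simp: BDD_iff in_\<Delta>_iff)

abbreviation "P \<equiv> oproj (\<Gamma> \<inter> \<Delta>)"

text \<open>The residual of the projection lies in the complement of \<Delta>, which is part of
  \<Gamma>, so projecting onto \<Delta> does not leave \<Gamma>.\<close>

lemma oproj_\<Delta>_eq_P: assumes x: "x \<in> \<Gamma>" shows "oproj \<Delta> x = P x"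
proof (rule oproj_eqI[OF subW(1), symmetric])
  have "x - oproj \<Delta> x \<in> \<Gamma>" using diff_oproj_in_comp[OF sub\<Delta>] comp_\<Delta>_subset by blast
  from subspace_diff[OF subspace_\<Gamma> x this]
  show "oproj \<Delta> x \<in> \<Gamma> \<inter> \<Delta>" using oproj_in[OF sub\<Delta>] by simp
  show "q \<in> \<Gamma> \<inter> \<Delta> \<Longrightarrow> inner (x - oproj \<Delta> x) q = 0" for q
    by (simp add: inner_diff_left oproj_inner[OF sub\<Delta>])
qed

lemma oproj_\<Gamma>_eq_P: assumes x: "x \<in> \<Delta>" shows "oproj \<Gamma> x = P x"
proof (rule oproj_eqI[OF subW(1), symmetric])
  have "x - oproj \<Gamma> x \<in> \<Delta>" using diff_oproj_in_comp[OF sub\<Gamma>] comp_\<Gamma>_subset by blast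
  from subspace_diff[OF subspace_\<Delta> x this]
  show "oproj \<Gamma> x \<in> \<Gamma> \<inter> \<Delta>" using oproj_in[OF sub\<Gamma>] by simp
  show "q \<in> \<Gamma> \<inter> \<Delta> \<Longrightarrow> inner (x - oproj \<Gamma> x) q = 0" for q
    by (simp add: inner_diff_left oproj_inner[OF sub\<Gamma>])
qed

text \<open>This recasts the Dirichlet condition, membership of u - u0 in the domain of -D*, as a
  value of the projection.\<close>

lemma P_eq_iff_comp:
  assumes x: "x \<in> \<Gamma>" and x0: "x0 \<in> \<Gamma> \<inter> \<Delta>"
  shows "P x = x0 \<longleftrightarrow> x - x0 \<in> \<Delta>\<^sup>\<bottom>"
proof
  assume "P x = x0"
  then show "x - x0 \<in> \<Delta>\<^sup>\<bottom>" using diff_oproj_in_comp[OF sub\<Delta>, of x] oproj_\<Delta>_eq_P[OF x] by simp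
next
  assume "x - x0 \<in> \<Delta>\<^sup>\<bottom>"
  then have "oproj \<Delta> x = x0"
    using x0 by (intro oproj_eqI[OF subspace_\<Delta>]) (auto simp: in_orthogonal_comp_iff)
  then show "P x = x0" using oproj_\<Delta>_eq_P[OF x] by simp
qed

text \<open>For f = (m u, a G u), membership in \<Delta> is the differential equation and the value
  of \<open>P\<close> is the Neumann condition; testing on all of \<Gamma> encodes both, because f -
  y is orthogonal to \<Gamma> and therefore lies in \<Delta>.\<close>

lemma weak_form_iff:
  assumes y: "y \<in> \<Gamma> \<inter> \<Delta>"
  shows "(\<forall>v\<in>\<Gamma>. inner f v = inner y v) \<longleftrightarrow> f \<in> \<Delta> \<and> P f = y"
proof
  assume eq: "\<forall>v\<in>\<Gamma>. inner f v = inner y v"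
  then have "f - y \<in> \<Delta>" using comp_\<Gamma>_subset by (auto simp: in_orthogonal_comp_iff inner_diff_left)
  from subspace_add[OF subspace_\<Delta> this, of y] have f: "f \<in> \<Delta>" using y by simp
  moreover have "oproj \<Gamma> f = y"
    using y eq by (intro oproj_eqI[OF subspace_\<Gamma>]) (auto simp: inner_diff_left)
  ultimately show "f \<in> \<Delta> \<and> P f = y" using oproj_\<Gamma>_eq_P by simp
next
  assume "f \<in> \<Delta> \<and> P f = y"
  then show "\<forall>v\<in>\<Gamma>. inner f v = inner y v"
    using oproj_\<Gamma>_eq_P[of f] oproj_inner[OF sub\<Gamma>, of _ f] by auto
qed

lemma proj_BDD_eq:
  assumes f: "f \<in> \<Delta>"
  shows "proj_BDD J0 J1 dG G dD D (snd f) = snd (P f)"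
proof -
  have w: "snd f \<in> dD" and fw: "f = (D (snd f), snd f)"
    using f by (auto simp: in_\<Delta>_iff prod_eq_iff)
  have iff: "(p \<in> BDD J0 J1 dG G dD D \<and> (\<forall>q\<in>BDD J0 J1 dG G dD D. ginner J1 J0 D (snd f - p) q = 0))
      \<longleftrightarrow> p = snd (P f)" for p
  proof
    assume p: "p \<in> BDD J0 J1 dG G dD D \<and> (\<forall>q\<in>BDD J0 J1 dG G dD D. ginner J1 J0 D (snd f - p) q = 0)"
    then have pW: "(D p, p) \<in> \<Gamma> \<inter> \<Delta>" by (simp add: BDD_iff)
    then have "D (snd f - p) = D (snd f) - D p"
      using clinear_on_diff(2)[OF D_lin w] by (simp add: in_\<Delta>_iff)
    then have fp: "(D (snd f - p), snd f - p) = f - (D p, p)" by (subst (3) fw) simp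
    have "inner (f - (D p, p)) q = 0" if "q \<in> \<Gamma> \<inter> \<Delta>" for q
    proof -
      have q: "q = (D (snd q), snd q)" using that by (auto simp: in_\<Delta>_iff prod_eq_iff)
      then have "snd q \<in> BDD J0 J1 dG G dD D" using that by (simp add: BDD_iff)
      then have "cinner (map_prod J0 J1) (f - (D p, p)) q = 0"
        using p ginner_D[of "snd f - p" "snd q"] fp q by metis
      then show ?thesis by (simp add: cinner_def complex_eq_iff)
    qed
    then show "p = snd (P f)" using oproj_eqI[OF subW(1) pW] by (metis snd_conv)
  next
    assume p: "p = snd (P f)"
    have "P f \<in> \<Gamma> \<inter> \<Delta>" by (rule oproj_in[OF subW])
    then have Pf: "P f = (D p, p)" "p \<in> dD" and pB: "p \<in> BDD J0 J1 dG G dD D"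
      using in_W_D by (auto simp: p in_\<Delta>_iff)
    have fp: "(D (snd f - p), snd f - p) = f - P f"
      using clinear_on_diff(2)[OF D_lin w Pf(2)] by (subst (3) fw) (simp add: Pf(1))
    have "ginner J1 J0 D (snd f - p) q = 0" if "q \<in> BDD J0 J1 dG G dD D" for q
    proof -
      have q: "(D q, q) \<in> \<Gamma> \<inter> \<Delta>" using that by (simp add: BDD_iff)
      have "\<forall>q\<in>\<Gamma> \<inter> \<Delta>. cinner (map_prod J0 J1) (f - P f) q = 0"
        by (subst cinner_eq_0_iff) (use J_\<Gamma> J_\<Delta> oproj_props[OF subW, of f] in auto)
      then show ?thesis using q unfolding ginner_D fp by blast
    qed
    then show "p \<in> BDD J0 J1 dG G dD D \<and> (\<forall>q\<in>BDD J0 J1 dG G dD D. ginner J1 J0 D (snd f - p) q = 0)"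
      using pB by blast
  qed
  show ?thesis unfolding proj_BDD_def iff by simp
qed

lemma bvp_condition_iff:
  assumes u0: "u0 \<in> BDG J0 J1 dG G dD D" and u: "u \<in> dG"
  shows "a (G u) \<in> dD \<and> m u - D (a (G u)) = 0 \<and> u - u0 \<in> adj_dom J1 J0 dD D
      \<longleftrightarrow> map_prod m a (u, G u) \<in> \<Delta> \<and> P (u, G u) = (u0, G u0)"
proof -
  have u0W: "(u0, G u0) \<in> \<Gamma> \<inter> \<Delta>" using u0 by (simp add: BDG_iff)
  have u\<Gamma>: "(u, G u) \<in> \<Gamma>" using u by (simp add: in_\<Gamma>_iff)
  have "G (u - u0) = G u - G u0"
    using clinear_on_diff(2)[OF G_lin u] u0W by (simp add: in_\<Gamma>_iff)
  then have "u - u0 \<in> adj_dom J1 J0 dD D \<longleftrightarrow> (u, G u) - (u0, G u0) \<in> \<Delta>\<^sup>\<bottom>"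
    by (auto simp: comp_\<Delta>_eq)
  then show ?thesis using P_eq_iff_comp[OF u\<Gamma> u0W] by (auto simp: in_\<Delta>_iff)
qed

section \<open>The Dirichlet problem and the Dirichlet-to-Neumann map\<close>

context
  fixes m :: "'a \<Rightarrow> 'a" and a :: "'b \<Rightarrow> 'b" and \<mu> :: real
  assumes m: "coercive \<mu> m" and a: "coercive \<mu> a"
begin

text \<open>Homogenisation: x = x0 + h with h in the complement of \<Delta>. As \<Delta> is its own
  double complement, the equation becomes a Lax-Milgram problem for h on that complement.\<close>

lemma bvp_ex1:
  assumes x0: "x0 \<in> \<Gamma> \<inter> \<Delta>"
  shows "\<exists>!x. x \<in> \<Gamma> \<and> map_prod m a x \<in> \<Delta> \<and> P x = x0"
proof -
  let ?A = "map_prod m a"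
  note co = coercive_map_prod[OF m a]
  interpret A: bounded_linear ?A using co by (simp add: coercive_def)
  note sub = subspace_orthogonal_comp[of \<Delta>] closed_orthogonal_comp[of \<Delta>]
  have A_iff: "?A x \<in> \<Delta> \<longleftrightarrow> (\<forall>v\<in>\<Delta>\<^sup>\<bottom>. inner (?A x) v = 0)" for x
    using orthogonal_comp_comp[OF sub\<Delta>] in_orthogonal_comp_iff[of "?A x" "\<Delta>\<^sup>\<bottom>"] by simp
  define h where "h = galerkin (\<Delta>\<^sup>\<bottom>) ?A (- ?A x0)"
  have h: "h \<in> \<Delta>\<^sup>\<bottom>" "\<And>v. v \<in> \<Delta>\<^sup>\<bottom> \<Longrightarrow> inner (?A h) v = inner (- ?A x0) v"
    unfolding h_def by (rule galerkin_in[OF sub co] galerkin_inner[OF sub co])+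
  have "x \<in> \<Gamma> \<and> ?A x \<in> \<Delta> \<and> P x = x0 \<longleftrightarrow> x = x0 + h" for x
  proof
    assume x: "x \<in> \<Gamma> \<and> ?A x \<in> \<Delta> \<and> P x = x0"
    then have "x - x0 \<in> \<Delta>\<^sup>\<bottom>" using P_eq_iff_comp x0 by blast
    moreover have "inner (?A (x - x0)) v = inner (- ?A x0) v" if "v \<in> \<Delta>\<^sup>\<bottom>" for v
      using that x A_iff by (simp add: A.diff inner_diff_left)
    ultimately have "h = x - x0" unfolding h_def by (rule galerkin_eqI[OF sub co])
    then show "x = x0 + h" by simp
  next
    assume x: "x = x0 + h"
    then have "x \<in> \<Gamma>" using h(1) comp_\<Delta>_subset x0 by (auto intro: subspace_add[OF subspace_\<Gamma>])
    moreover have "?A x \<in> \<Delta>" unfolding A_iff x using h(2) by (simp add: A.add inner_add_left)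
    moreover have "P x = x0" using P_eq_iff_comp[OF \<open>x \<in> \<Gamma>\<close> x0] h(1) x by simp
    ultimately show "x \<in> \<Gamma> \<and> ?A x \<in> \<Delta> \<and> P x = x0" by blast
  qed
  then show ?thesis by simp
qed

lemma bvp_sol_eqI:
  assumes x: "x \<in> \<Gamma>" "map_prod m a x \<in> \<Delta>" and P: "P x = (u0, G u0)"
  shows "bvp_sol J0 J1 dG G dD D a m u0 = fst x"
proof -
  have u0W: "(u0, G u0) \<in> \<Gamma> \<inter> \<Delta>" using oproj_in[OF subW, of x] P by simp
  then have u0: "u0 \<in> BDG J0 J1 dG G dD D" by (simp add: BDG_iff)
  have xu: "fst x \<in> dG" "x = (fst x, G (fst x))" using x by (auto simp: in_\<Gamma>_iff prod_eq_iff)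
  show ?thesis
    unfolding bvp_sol_def
  proof (rule the_equality)
    show "fst x \<in> dG \<and> a (G (fst x)) \<in> dD \<and> m (fst x) - D (a (G (fst x))) = 0 \<and> fst x - u0 \<in> adj_dom J1 J0 dD D"
      using bvp_condition_iff[OF u0 xu(1), of a m] x P xu by metis
  next
    fix u assume u: "u \<in> dG \<and> a (G u) \<in> dD \<and> m u - D (a (G u)) = 0 \<and> u - u0 \<in> adj_dom J1 J0 dD D"
    then have "(u, G u) \<in> \<Gamma> \<and> map_prod m a (u, G u) \<in> \<Delta> \<and> P (u, G u) = (u0, G u0)"
      using bvp_condition_iff[OF u0, of u a m] by (simp add: in_\<Gamma>_iff)
    then have "(u, G u) = x" using bvp_ex1[OF u0W] x P by blast
    then show "u = fst x" by auto
  qed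
qed

lemma DtN_eq:
  assumes x: "x \<in> \<Gamma>" "map_prod m a x \<in> \<Delta>" and P: "P x = (u0, G u0)"
  shows "DtN J0 J1 dG G dD D a m u0 = snd (P (map_prod m a x))"
proof -
  have "a (G (fst x)) = snd (map_prod m a x)" using x(1) by (simp add: in_\<Gamma>_iff)
  then show ?thesis unfolding DtN_def bvp_sol_eqI[OF assms] by (simp only: proj_BDD_eq[OF x(2)])
qed

end

text \<open>Extending to the whole product makes the adjoint that of an everywhere defined bounded
  operator.\<close>

definition K :: "'a \<times> 'b \<Rightarrow> 'c" where "K x = \<kappa> (fst (P x))"

lemma bounded_linear_K: "bounded_linear K"
proof -
  interpret P: bounded_linear P by (rule bounded_linear_oproj[OF subW])
  have PB: "fst (P x) \<in> BDG J0 J1 dG G dD D" "P x = (fst (P x), G (fst (P x)))" for x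
    using in_W_G[OF oproj_in[OF subW]] by blast+
  obtain C where C: "\<And>u. u \<in> BDG J0 J1 dG G dD D \<Longrightarrow> norm (\<kappa> u) \<le> C * gnorm G u"
    using \<kappa>_bdd by blast
  show ?thesis
  proof (rule bounded_linear_intro[where K = "\<bar>C\<bar>"])
    show "K (x + y) = K x + K y" for x y
      using \<kappa>_lin PB(1) by (simp add: K_def P.add clinear_on_def)
    show "K (c *\<^sub>R x) = c *\<^sub>R K x" for c x
      using \<kappa>_lin PB(1) by (simp add: K_def P.scaleR clinear_on_def)
    fix x
    have "gnorm G (fst (P x)) = norm (P x)"
      by (subst (2) PB(2)) (simp add: gnorm_def norm_Pair)
    then have "norm (K x) \<le> C * norm (P x)" using C[OF PB(1)[of x]] by (simp add: K_def)
    also have "\<dots> \<le> \<bar>C\<bar> * norm (P x)" by (simp add: mult_right_mono)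
    also have "\<dots> \<le> \<bar>C\<bar> * norm x" by (intro mult_left_mono norm_oproj_le[OF subW]) simp
    finally show "norm (K x) \<le> norm x * \<bar>C\<bar>" by (simp add: mult.commute)
  qed
qed

context
  fixes K' assumes adj: "\<And>x \<psi>. inner (K x) \<psi> = inner x (K' \<psi>)"
begin

text \<open>\<open>K\<close> factors through the self-adjoint \<open>P\<close>, so its adjoint is
  fixed by \<open>P\<close>.\<close>

lemma adjoint_K_in: "K' \<psi> \<in> \<Gamma> \<inter> \<Delta>"
proof -
  have "P (K' \<psi>) = K' \<psi>"
  proof (subst vector_eq_ldot[symmetric], rule allI)
    fix x
    have "K (P x) = K x" by (simp add: K_def oproj_id[OF subW oproj_in[OF subW]])
    then have "inner (P x) (K' \<psi>) = inner x (K' \<psi>)" by (metis adj)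
    then show "inner x (P (K' \<psi>)) = inner x (K' \<psi>)" by (simp add: oproj_self_adjoint[OF subW])
  qed
  then show ?thesis using oproj_in[OF subW] by metis
qed

text \<open>Together with \<open>adjoint_K_in\<close> this shows that the second entry of
  \<open>K' \<psi>\<close> is G applied to the adjoint of \<kappa> at \<psi>, the Neumann
  datum.\<close>

lemma kappa_adj_eq: "kappa_adj J0 J1 JH dG G dD D \<kappa> \<psi> = fst (K' \<psi>)"
proof -
  have K: "K (u, G u) = \<kappa> u" if "u \<in> BDG J0 J1 dG G dD D" for u
    using that by (simp add: K_def oproj_id[OF subW] BDG_iff)
  have K'W: "K' \<psi> = (fst (K' \<psi>), G (fst (K' \<psi>)))"
    using adjoint_K_in[of \<psi>] by (simp add: in_\<Gamma>_iff prod_eq_iff)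
  have "cinner JH (\<kappa> u) \<psi> = ginner J0 J1 G u (fst (K' \<psi>))" if u: "u \<in> BDG J0 J1 dG G dD D" for u
  proof -
    have Ju: "J0 u \<in> BDG J0 J1 dG G dD D" "\<kappa> (J0 u) = JH (\<kappa> u)"
      using \<kappa>_lin u by (auto simp: clinear_on_def csubspace_def)
    have GJ: "(J0 u, G (J0 u)) = map_prod J0 J1 (u, G u)"
      using u G_lin by (simp add: BDG_iff in_\<Gamma>_iff clinear_on_def)
    have re: "inner (\<kappa> u) \<psi> = inner (u, G u) (K' \<psi>)" using adj[of "(u, G u)" \<psi>] K[OF u] by simp
    have "inner (JH (\<kappa> u)) \<psi> = inner (map_prod J0 J1 (u, G u)) (K' \<psi>)"
      using adj[of "(J0 u, G (J0 u))" \<psi>] K[OF Ju(1)] Ju(2) GJ by simp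
    then have "inner (\<kappa> u) (JH \<psi>) = inner (u, G u) (map_prod J0 J1 (K' \<psi>))"
      unfolding cstruct_inner_right[OF JH] cstruct_inner_right[OF cstruct_prod] by simp
    with re show ?thesis unfolding ginner_G K'W[symmetric] cinner_def by simp
  qed
  moreover have "w = fst (K' \<psi>)" if w: "w \<in> BDG J0 J1 dG G dD D"
      "\<forall>u\<in>BDG J0 J1 dG G dD D. cinner JH (\<kappa> u) \<psi> = ginner J0 J1 G u w" for w
  proof -
    have wW: "(w, G w) \<in> \<Gamma> \<inter> \<Delta>" using w(1) by (simp add: BDG_iff)
    define d where "d = (w, G w) - K' \<psi>"
    have dW: "d \<in> \<Gamma> \<inter> \<Delta>" unfolding d_def by (rule subspace_diff[OF subW(1) wW adjoint_K_in])
    then have du: "d = (fst d, G (fst d))" and dB: "fst d \<in> BDG J0 J1 dG G dD D"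
      using in_W_G by blast+
    have "inner (\<kappa> (fst d)) \<psi> = inner d (w, G w)"
      using w(2)[rule_format, OF dB] du by (simp add: ginner_G cinner_def)
    moreover have "inner (\<kappa> (fst d)) \<psi> = inner d (K' \<psi>)"
      using adj[of d \<psi>] K[OF dB] du by simp
    ultimately have "inner d d = 0" by (subst (2) d_def) (simp add: inner_diff_right)
    then have "(w, G w) = K' \<psi>" by (simp add: d_def)
    then show ?thesis by (metis fst_conv)
  qed
  moreover have "fst (K' \<psi>) \<in> BDG J0 J1 dG G dD D"
    using adjoint_K_in[of \<psi>] K'W by (simp add: BDG_iff)
  ultimately show ?thesis unfolding kappa_adj_def by (intro the_equality) blast+
qed

text \<open>By \<open>weak_form_iff\<close>, prescribing the Neumann datum selects the variational
  solution for \<open>K' \<psi>\<close>; \<phi> is then its boundary value under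
  \<open>K\<close>.\<close>

lemma DtN_H_inv_eq:
  assumes m: "coercive \<mu> m" and a: "coercive \<mu> a"
  shows "DtN_H_inv J0 J1 JH dG G dD D \<kappa> a m \<psi> = K (galerkin \<Gamma> (map_prod m a) (K' \<psi>))"
proof -
  let ?A = "map_prod m a" and ?y = "K' \<psi>"
  note co = coercive_map_prod[OF m a]
  have y: "?y \<in> \<Gamma> \<inter> \<Delta>" by (rule adjoint_K_in)
  have Gy: "G (kappa_adj J0 J1 JH dG G dD D \<kappa> \<psi>) = snd ?y"
    using y by (simp add: kappa_adj_eq in_\<Gamma>_iff)
  define x where "x = galerkin \<Gamma> ?A ?y"
  have x\<Gamma>: "x \<in> \<Gamma>" unfolding x_def by (rule galerkin_in[OF sub\<Gamma> co])
  have Ax: "?A x \<in> \<Delta>" "P (?A x) = ?y"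
    using weak_form_iff[OF y, of "?A x"] galerkin_inner[OF sub\<Gamma> co] by (auto simp: x_def)
  have Px: "P x = (fst (P x), G (fst (P x)))" "fst (P x) \<in> BDG J0 J1 dG G dD D"
    using in_W_G[OF oproj_in[OF subW]] by blast+
  have "DtN_H J0 J1 JH dG G dD D \<kappa> a m \<phi> \<psi> \<longleftrightarrow> \<phi> = K x" for \<phi>
  proof
    assume "DtN_H J0 J1 JH dG G dD D \<kappa> a m \<phi> \<psi>"
    then obtain u0 where u0: "u0 \<in> BDG J0 J1 dG G dD D" "\<kappa> u0 = \<phi>"
      and dtn: "DtN J0 J1 dG G dD D a m u0 = snd ?y" unfolding DtN_H_def Gy by blast
    have "(u0, G u0) \<in> \<Gamma> \<inter> \<Delta>" using u0 by (simp add: BDG_iff)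
    from bvp_ex1[OF m a this] obtain z where z: "z \<in> \<Gamma>" "?A z \<in> \<Delta>" "P z = (u0, G u0)" by blast
    have "snd (P (?A z)) = snd ?y" using dtn DtN_eq[OF m a z] by simp
    \<comment> \<open>Elements of \<Delta> are determined by their second entry, which is all that
      the Dirichlet-to-Neumann map reveals.\<close>
    moreover have "P (?A z) \<in> \<Delta>" "?y \<in> \<Delta>" using oproj_in[OF subW] y by blast+
    ultimately have "P (?A z) = ?y" by (simp add: in_\<Delta>_iff prod_eq_iff)
    then have "\<forall>v\<in>\<Gamma>. inner (?A z) v = inner ?y v" using weak_form_iff[OF y] z(2) by blast
    then have "x = z" unfolding x_def by (intro galerkin_eqI[OF sub\<Gamma> co z(1)]) blast
    then show "\<phi> = K x" using z(3) u0(2) by (simp add: K_def)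
  next
    assume "\<phi> = K x"
    moreover have "DtN J0 J1 dG G dD D a m (fst (P x)) = snd ?y"
      using DtN_eq[OF m a x\<Gamma> Ax(1) Px(1)] Ax(2) by simp
    ultimately show "DtN_H J0 J1 JH dG G dD D \<kappa> a m \<phi> \<psi>"
      unfolding DtN_H_def Gy using Px(2) by (auto simp: K_def)
  qed
  then show ?thesis by (simp add: DtN_H_inv_def x_def)
qed

end

end

theorem theorem4p2:
  fixes J0 :: "'a::{real_inner,complete_space} \<Rightarrow> 'a"
    and J1 :: "'b::{real_inner,complete_space} \<Rightarrow> 'b"
    and JH :: "'c::{real_inner,complete_space} \<Rightarrow> 'c"
    and dG :: "'a set" and G :: "'a \<Rightarrow> 'b"
    and dD :: "'b set" and D :: "'b \<Rightarrow> 'a"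
    and \<kappa> :: "'a \<Rightarrow> 'c"
    and mn :: "nat \<Rightarrow> 'a \<Rightarrow> 'a" and m :: "'a \<Rightarrow> 'a"
    and an :: "nat \<Rightarrow> 'b \<Rightarrow> 'b" and a :: "'b \<Rightarrow> 'b"
    and \<mu> :: real
  assumes J0: "cstruct J0" and J1: "cstruct J1" and JH: "cstruct JH"
    and G: "dd_closed_op J0 J1 dG G"
    and D: "dd_closed_op J1 J0 dD D"
    and GD: "adj_dom J0 J1 dG G \<subseteq> dD"
            "\<forall>y\<in>adj_dom J0 J1 dG G. D y = - adj J0 J1 dG G y"
    and cpt: "compact (closure {u\<in>dG. gnorm G u \<le> 1})"
    and \<kappa>_lin: "clinear_on J0 JH (BDG J0 J1 dG G dD D) \<kappa>"
    and \<kappa>_bdd: "\<exists>C. \<forall>u\<in>BDG J0 J1 dG G dD D. norm (\<kappa> u) \<le> C * gnorm G u"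
    and \<kappa>_inj: "inj_on \<kappa> (BDG J0 J1 dG G dD D)"
    and \<kappa>_dense: "closure (\<kappa> ` BDG J0 J1 dG G dD D) = UNIV"
    and mn_bdd: "\<forall>n. bounded_clinear_J J0 J0 (mn n)" and m_bdd: "bounded_clinear_J J0 J0 m"
    and an_bdd: "\<forall>n. bounded_clinear_J J1 J1 (an n)" and a_bdd: "bounded_clinear_J J1 J1 a"
    and \<mu>: "\<mu> > 0"
    and mn_coer: "\<forall>n x. Re (cinner J0 (mn n x) x) \<ge> \<mu> * (norm x)\<^sup>2"
    and m_coer: "\<forall>x. Re (cinner J0 (m x) x) \<ge> \<mu> * (norm x)\<^sup>2"
    and an_coer: "\<forall>n y. Re (cinner J1 (an n y) y) \<ge> \<mu> * (norm y)\<^sup>2"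
    and a_coer: "\<forall>y. Re (cinner J1 (a y) y) \<ge> \<mu> * (norm y)\<^sup>2"
    and an_sup: "bdd_above (range (\<lambda>n. onorm (an n)))"
    and m_wot: "\<forall>x y. (\<lambda>n. cinner J0 (mn n x) y) \<longlonglongrightarrow> cinner J0 (m x) y"
    and a_wot: "\<forall>x\<in>G ` dG. \<forall>y\<in>G ` dG.
        (\<lambda>n. cinner J1 (compr_inv J1 (G ` dG) (an n) x) y) \<longlonglongrightarrow> cinner J1 (compr_inv J1 (G ` dG) a x) y"
  shows "(\<forall>x y. (\<lambda>n. cinner JH (DtN_H_inv J0 J1 JH dG G dD D \<kappa> (an n) (mn n) x) y)
             \<longlonglongrightarrow> cinner JH (DtN_H_inv J0 J1 JH dG G dD D \<kappa> a m x) y)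
       \<and> (compact (closure (\<kappa> ` {u\<in>BDG J0 J1 dG G dD D. gnorm G u \<le> 1})) \<longrightarrow>
           (\<lambda>n. onorm (\<lambda>x. DtN_H_inv J0 J1 JH dG G dD D \<kappa> (an n) (mn n) x
                            - DtN_H_inv J0 J1 JH dG G dD D \<kappa> a m x)) \<longlonglongrightarrow> 0)"
proof -
  interpret op: operator_pair J0 J1 JH dG G dD D \<kappa>
    using J0 J1 JH G D GD \<kappa>_lin \<kappa>_bdd by unfold_locales
  have norm_graph: "norm (u, G u) = gnorm G u" for u by (simp add: norm_Pair gnorm_def)
  have "fst ` (op.\<Gamma> \<inter> cball 0 1) = {u\<in>dG. gnorm G u \<le> 1}"
    by (force simp: op.\<Gamma>_def norm_graph image_iff)
  then interpret compact_graph op.\<Gamma>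
    using op.sub\<Gamma> cpt by unfold_locales simp_all
  have R: "snd ` op.\<Gamma> = G ` dG" by (simp add: op.\<Gamma>_def image_image)
  have co: "coercive \<mu> (mn n)" "coercive \<mu> m" "coercive \<mu> (an n)" "coercive \<mu> a" for n
    using \<mu> mn_bdd m_bdd an_bdd a_bdd mn_coer m_coer an_coer a_coer
    by (auto simp: coercive_def bounded_clinear_J_def cinner_def)
  obtain M where M: "\<And>n. onorm (an n) \<le> M" using an_sup by (auto simp: bdd_above_def)
  have an_bound: "norm (an n y) \<le> M * norm y" for n y
    using onorm[of "an n" y] mult_right_mono[OF M[of n] norm_ge_zero[of y]] an_bdd
    by (auto simp: bounded_clinear_J_def)
  have m_weak: "(\<lambda>n. inner (mn n x) y) \<longlonglongrightarrow> inner (m x) y" for x y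
    using tendsto_Re[OF m_wot[rule_format, of x y]] by (simp add: cinner_def)
  have JR: "J1 q \<in> G ` dG" if "q \<in> G ` dG" for q
    using that op.G_lin by (force simp: clinear_on_def csubspace_def)
  have compr: "compr_inv J1 (G ` dG) b p = galerkin (G ` dG) b p" if "p \<in> G ` dG" for b p
    by (rule compr_inv_eq_galerkin[OF subspace_range[unfolded R] closed_range[unfolded R] JR that])
  have a_weak: "(\<lambda>n. inner (galerkin (snd ` op.\<Gamma>) (an n) p) y) \<longlonglongrightarrow> inner (galerkin (snd ` op.\<Gamma>) a p) y"
    if "p \<in> snd ` op.\<Gamma>" "y \<in> snd ` op.\<Gamma>" for p y
    using tendsto_Re[OF a_wot[rule_format, of p y]] that by (simp add: R compr cinner_def)
  obtain K' where K': "bounded_linear K'" and adj: "\<And>x \<psi>. inner (op.K x) \<psi> = inner x (K' \<psi>)"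
    using bounded_adjoint_exists[OF op.bounded_linear_K] by blast
  note inv_n = op.DtN_H_inv_eq[OF adj co(1,3)] and inv = op.DtN_H_inv_eq[OF adj co(2,4)]
  have "(\<lambda>n. inner (DtN_H_inv J0 J1 JH dG G dD D \<kappa> (an n) (mn n) x) y)
      \<longlonglongrightarrow> inner (DtN_H_inv J0 J1 JH dG G dD D \<kappa> a m x) y" for x y
    unfolding inv_n inv adj
    by (rule galerkin_weak_convergence[OF co an_bound m_weak a_weak])
  \<comment> \<open>The imaginary part is the real inner product with \<open>JH y\<close>, so real
    weak convergence covers it.\<close>
  then have weak: "(\<lambda>n. cinner JH (DtN_H_inv J0 J1 JH dG G dD D \<kappa> (an n) (mn n) x) y)
      \<longlonglongrightarrow> cinner JH (DtN_H_inv J0 J1 JH dG G dD D \<kappa> a m x) y" for x y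
    unfolding cinner_def by (intro tendsto_Complex)
  have "(\<lambda>n. onorm (\<lambda>x. DtN_H_inv J0 J1 JH dG G dD D \<kappa> (an n) (mn n) x
      - DtN_H_inv J0 J1 JH dG G dD D \<kappa> a m x)) \<longlonglongrightarrow> 0"
    if c: "compact (closure (\<kappa> ` {u\<in>BDG J0 J1 dG G dD D. gnorm G u \<le> 1}))"
    unfolding inv_n inv
  proof (rule galerkin_norm_convergence[OF co an_bound m_weak a_weak op.bounded_linear_K K' adj])
    \<comment> \<open>The projection is a contraction and the graph norm is the product norm, so
      \<open>K\<close> maps the unit ball into the set assumed relatively compact.\<close>
    have "op.K x \<in> \<kappa> ` {u\<in>BDG J0 J1 dG G dD D. gnorm G u \<le> 1}" if "norm x \<le> 1" for x
    proof -
      note W = op.in_W_G[OF oproj_in[OF op.subW, of x]]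
      have "gnorm G (fst (op.P x)) = norm (op.P x)" using W norm_graph by metis
      then have "gnorm G (fst (op.P x)) \<le> 1"
        using norm_oproj_le[OF op.subW, of x] that by simp
      then show ?thesis using W unfolding op.K_def by blast
    qed
    then have "op.K ` cball 0 1 \<subseteq> \<kappa> ` {u\<in>BDG J0 J1 dG G dD D. gnorm G u \<le> 1}" by auto
    from compact_Int_closed[OF c closed_closure[of "op.K ` cball 0 1"]] closure_mono[OF this]
    show "compact (closure (op.K ` cball 0 1))" by (simp add: Int_absorb1)
  qed
  with weak show ?thesis by blast
qed

end
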